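(* Let $g:[0,\infty)\to(0,\infty)$ be an $\mathrm{RV}_{-1}$-function with $\int_0^\infty g(t)\,dt=\infty$ and $t^{-1}=O(g(t))$ as $t\to\infty$. Let $T\in\mathcal L_g$, $T\ge0$, and suppose there are a constant $c_0$, a choice of sign $\pm$, and a decreasing function $\varepsilon:[t_0,\infty)\to(0,\infty)$ with $\lim_{t\to\infty}\varepsilon(t)=0$ such that $$\lambda_j(T)=g(j)\bigl(c_0\pm\varepsilon(j)+o(\varepsilon(j))\bigr)\ \text{ as } j\to\infty\qquad\text{and}\qquad tg(t)=o\Bigl(\int_{t_0}^t\varepsilon(s)g(s)\,ds\Bigr)\ \text{ as } t\to\infty .$$ Then $T$ is not $g$-hypermeasurable.
   Context: $\mathcal H$ is a separable (infinite-dimensional) Hilbert space, and $\mu_0(T)\ge\mu_1(T)\ge\cdots$ are the singular values of a compact operator $T$ on $\mathcal H$. A continuous function $g:[0,\infty)\to(0,\infty)$ is $\mathrm{RV}_{-1}$ if it is ultimately monotonic and $\lim_{t\to\infty}g(\lambda t)/g(t)=\lambda^{-1}$ for all $\lambda>0$. The weak Lorentz ideal is $\mathcal L_g=\{T \text{ compact}:\mu_j(T)=O(g(j))\}$. For $T\ge0$ compact, $\lambda_0(T)\ge\lambda_1(T)\ge\cdots\ge0$ are its eigenvalues counted with multiplicity. A trace on $\mathcal L_g$ is a linear functional $\varphi:\mathcal L_g\to\mathbb C$ (no continuity or positivity required) vanishing on all commutators $[A,T]$ with $A$ bounded and $T\in\mathcal L_g$. It is $g$-normalized if $\varphi(T_g)=1$,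 where $T_g$ is any operator with $T_g\xi_j=g(j)\xi_j$, $j\ge0$, for some orthonormal basis $(\xi_j)_{j\ge0}$ of $\mathcal H$. An operator $T\in\mathcal L_g$ is $g$-hypermeasurable if all $g$-normalized traces on $\mathcal L_g$ take the same value on $T$. *)

theory Defs
  imports "HOL-Analysis.Analysis"
begin

text \<open>The inner product is linear in the first argument and induces the norm of the type class
  \<^class>\<open>banach\<close>, so that topology, completeness and boundedness are those of the library.\<close>

class complex_hilbert_space = banach +
  fixes cscale :: "complex \<Rightarrow> 'a \<Rightarrow> 'a"
    and cinner :: "'a \<Rightarrow> 'a \<Rightarrow> complex"
  assumes cscale_add_right: "cscale c (x + y) = cscale c x + cscale c y"
    and cscale_add_left: "cscale (c + d) x = cscale c x + cscale d x"
    and cscale_cscale: "cscale c (cscale d x) = cscale (c * d) x"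
    and cscale_of_real: "cscale (complex_of_real r) x = r *\<^sub>R x"
    and cinner_commute: "cinner x y = cnj (cinner y x)"
    and cinner_add_left: "cinner (x + y) z = cinner x z + cinner y z"
    and cinner_scale_left: "cinner (cscale c x) y = c * cinner x y"
    and cinner_same: "cinner x x = complex_of_real ((norm x)\<^sup>2)"

lemma vector_space_cscale:
  "vector_space (cscale :: complex \<Rightarrow> 'a::complex_hilbert_space \<Rightarrow> 'a)"
proof
  show "cscale 1 x = x" for x :: 'a
    using cscale_of_real[of 1 x] by simp
qed (simp_all add: cscale_add_right cscale_add_left cscale_cscale)

global_interpretation complex_vector:
  vector_space "cscale :: complex \<Rightarrow> 'a::complex_hilbert_space \<Rightarrow> 'a"
  defines cspan = complex_vector.span
    and cdim = complex_vector.dim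
  by (rule vector_space_cscale)

definition infinite_dimensional :: "'a::complex_hilbert_space itself \<Rightarrow> bool" where
  "infinite_dimensional _ \<longleftrightarrow> (\<nexists>B :: 'a set. finite B \<and> cspan B = UNIV)"

definition orthonormal_basis :: "(nat \<Rightarrow> 'a::complex_hilbert_space) \<Rightarrow> bool" where
  "orthonormal_basis \<xi> \<longleftrightarrow>
     (\<forall>i j. cinner (\<xi> i) (\<xi> j) = (if i = j then 1 else 0)) \<and>
     closure (cspan (range \<xi>)) = UNIV"

definition bounded_op :: "('a::complex_hilbert_space \<Rightarrow> 'a) \<Rightarrow> bool" where
  "bounded_op T \<longleftrightarrow> bounded_linear T \<and> (\<forall>c x. T (cscale c x) = cscale c (T x))"

definition compact_op :: "('a::complex_hilbert_space \<Rightarrow> 'a) \<Rightarrow> bool" where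
  "compact_op T \<longleftrightarrow> bounded_op T \<and> compact (closure (T ` cball 0 1))"

definition positive_op :: "('a::complex_hilbert_space \<Rightarrow> 'a) \<Rightarrow> bool" where
  "positive_op T \<longleftrightarrow> bounded_op T \<and> (\<forall>x. cinner (T x) x \<in> \<real>\<^sub>\<ge>\<^sub>0)"

definition adjoint_op :: "('a::complex_hilbert_space \<Rightarrow> 'a) \<Rightarrow> 'a \<Rightarrow> 'a" where
  "adjoint_op T = (THE S. \<forall>x y. cinner (T x) y = cinner x (S y))"

text \<open>\<open>eigenvalue_sequence T l\<close> says that \<open>l\<close> lists the eigenvalues of the positive compact
  operator \<open>T\<close> in decreasing order, each positive eigenvalue occurring as often as its multiplicity.
  As usual, the list of the positive eigenvalues is continued by zeros if it is finite; if it is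
  infinite, the value \<open>0\<close> does not occur, whatever the kernel of \<open>T\<close> is. Values \<open>s > 0\<close>
  that are not eigenvalues have a trivial eigenspace and hence do not occur in \<open>l\<close> (convergence
  to \<open>0\<close> makes each level set finite, so that \<^const>\<open>card\<close> is a true count).\<close>

definition eigenvalue_sequence ::
    "('a::complex_hilbert_space \<Rightarrow> 'a) \<Rightarrow> (nat \<Rightarrow> real) \<Rightarrow> bool" where
  "eigenvalue_sequence T l \<longleftrightarrow>
     antimono l \<and> (\<forall>j. 0 \<le> l j) \<and> l \<longlonglongrightarrow> 0 \<and>
     (\<forall>s>0. card {j. l j = s} = cdim {x. T x = s *\<^sub>R x})"

lemma eigenvalue_sequence_unique:
  assumes "eigenvalue_sequence T l" "eigenvalue_sequence T m"
  shows "l = m"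
proof (rule ccontr)
  assume "l \<noteq> m"
  then obtain j where j: "l j \<noteq> m j" and least: "\<And>i. i < j \<Longrightarrow> l i = m i"
    using exists_least_iff[of "\<lambda>j. l j \<noteq> m j"] by (auto simp: fun_eq_iff)
  have False
    if p: "eigenvalue_sequence T p" and q: "eigenvalue_sequence T q"
      and less: "q j < p j" and eq: "\<And>i. i < j \<Longrightarrow> p i = q i" for p q
  proof -
    have s: "p j > 0"
      using q less by (auto simp: eigenvalue_sequence_def intro: le_less_trans)
    have "eventually (\<lambda>i. p i < p j) sequentially"
      using p s by (auto simp: eigenvalue_sequence_def intro: order_tendstoD)
    then obtain n where n: "\<And>i. n \<le> i \<Longrightarrow> p i < p j"
      by (auto simp: eventually_sequentially)
    have fin: "finite {i. p i = p j}"
      by (rule finite_subset[of _ "{..<n}"]) (use n in \<open>force simp: not_le[symmetric]\<close>, simp)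
    have "i < j" if "q i = p j" for i
    proof (rule ccontr)
      assume "\<not> i < j"
      then have "q i \<le> q j"
        using q by (auto simp: eigenvalue_sequence_def antimono_def)
      then show False using that less by simp
    qed
    then have "{i. q i = p j} \<subset> {i. p i = p j}"
      using eq less by auto
    from psubset_card_mono[OF fin this] show False
      using p q s by (simp add: eigenvalue_sequence_def)
  qed
  from this[of l m] this[of m l] assms j least show False
    by (metis linorder_neqE_linordered_idom)
qed

definition eigval :: "('a::complex_hilbert_space \<Rightarrow> 'a) \<Rightarrow> nat \<Rightarrow> real" where
  "eigval T = (THE l. eigenvalue_sequence T l)"

definition singval :: "('a::complex_hilbert_space \<Rightarrow> 'a) \<Rightarrow> nat \<Rightarrow> real" where
  "singval T j = sqrt (eigval (adjoint_op T \<circ> T) j)"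

definition RV_minus_one :: "(real \<Rightarrow> real) \<Rightarrow> bool" where
  "RV_minus_one g \<longleftrightarrow>
     continuous_on {0..} g \<and> (\<forall>t\<ge>0. 0 < g t) \<and>
     (\<exists>a\<ge>0. mono_on {a..} g \<or> antimono_on {a..} g) \<and>
     (\<forall>l>0. ((\<lambda>t. g (l * t) / g t) \<longlongrightarrow> inverse l) at_top)"

definition weak_lorentz_ideal ::
    "(real \<Rightarrow> real) \<Rightarrow> ('a::complex_hilbert_space \<Rightarrow> 'a) set" where
  "weak_lorentz_ideal g = {T. compact_op T \<and> singval T \<in> O(\<lambda>j. g (real j))}"

text \<open>A trace is a linear functional on the ideal only; the total function representing it is
  unconstrained outside the ideal.\<close>

definition is_trace ::
    "(real \<Rightarrow> real) \<Rightarrow> (('a::complex_hilbert_space \<Rightarrow> 'a) \<Rightarrow> complex) \<Rightarrow> bool" where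
  "is_trace g \<phi> \<longleftrightarrow>
     (\<forall>S\<in>weak_lorentz_ideal g. \<forall>T\<in>weak_lorentz_ideal g. \<phi> (\<lambda>x. S x + T x) = \<phi> S + \<phi> T) \<and>
     (\<forall>c. \<forall>T\<in>weak_lorentz_ideal g. \<phi> (\<lambda>x. cscale c (T x)) = c * \<phi> T) \<and>
     (\<forall>A. \<forall>T\<in>weak_lorentz_ideal g. bounded_op A \<longrightarrow> \<phi> (\<lambda>x. A (T x) - T (A x)) = 0)"

definition is_T_g :: "(real \<Rightarrow> real) \<Rightarrow> ('a::complex_hilbert_space \<Rightarrow> 'a) \<Rightarrow> bool" where
  "is_T_g g S \<longleftrightarrow>
     bounded_op S \<and> (\<exists>\<xi>. orthonormal_basis \<xi> \<and> (\<forall>j. S (\<xi> j) = g (real j) *\<^sub>R \<xi> j))"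

definition normalized_trace ::
    "(real \<Rightarrow> real) \<Rightarrow> (('a::complex_hilbert_space \<Rightarrow> 'a) \<Rightarrow> complex) \<Rightarrow> bool" where
  "normalized_trace g \<phi> \<longleftrightarrow> is_trace g \<phi> \<and> (\<forall>S. is_T_g g S \<longrightarrow> \<phi> S = 1)"

definition hypermeasurable ::
    "(real \<Rightarrow> real) \<Rightarrow> ('a::complex_hilbert_space \<Rightarrow> 'a) \<Rightarrow> bool" where
  "hypermeasurable g T \<longleftrightarrow>
     T \<in> weak_lorentz_ideal g \<and>
     (\<forall>\<phi> \<psi>. normalized_trace g \<phi> \<and> normalized_trace g \<psi> \<longrightarrow> \<phi> T = \<psi> T)"

end

theory Submission
  imports Defs "HOL-Library.Function_Algebras"
begin

text \<open>Let \<open>Com\<close> be the span of the commutators \<open>[A, X]\<close> with \<open>A\<close> bounded and \<open>X\<close> in the ideal. Linear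
  functionals vanishing on \<open>Com\<close> are traces, and all operators \<open>T\<^sub>g\<close> agree modulo \<open>Com\<close> with the operator
  \<open>S\<close> having eigenvalues \<open>g(j)\<close> at the eigenvectors \<open>e j\<close> of \<open>T\<close> and vanishing on their orthogonal
  complement (\<open>T_g_commutator_equivalent\<close>). So two \<open>g\<close>-normalized traces with different values at
  \<open>T\<close> exist as soon as \<open>T\<close> and \<open>S\<close> are linearly independent modulo \<open>Com\<close> (\<open>not_hypermeasurable_of_independent\<close>).

  Suppose that \<open>X = a T + b S\<close> lies in \<open>Com\<close>. If an operator of the ideal is cut off at its first \<open>n\<close>
  singular vectors, the remainder has norm \<open>O(g(n))\<close>, and on a finite-dimensional space that contains
  these vectors and their images the cut-off operator contributes nothing to the trace of a
  commutator. Hence the trace of \<open>X\<close> on suitable spaces of dimension \<open>O(n)\<close> is \<open>O(n g(n))\<close>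
  (\<open>com_space_small_traces\<close>). Such a space may be chosen to contain \<open>e 0, \<dots>, e (n - 1)\<close>, and what it
  contains besides these contributes \<open>O(n g(n))\<close> again. So
  \<open>\<Sum>j<n. (a \<lambda>\<^sub>j(T) + b g(j)) = O(n g(n))\<close> (\<open>small_traces_eigenvalue_sums\<close>).

  The summands are \<open>g(j) (\<kappa> + a (\<plusminus>\<epsilon>(j) + o(\<epsilon>(j))))\<close> with \<open>\<kappa> = a c\<^sub>0 + b\<close>. Unless \<open>a = b = 0\<close>, their
  components in a suitable direction of the complex plane are at least \<open>\<delta> \<epsilon>(j) g(j)\<close> for some \<open>\<delta> > 0\<close>
  (\<open>weights_one_sided\<close>). The sum then has at least the order of \<open>\<integral> \<epsilon> g\<close>, which \<open>n g(n)\<close> does not reach: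
  a contradiction (\<open>eigenvalue_sums_not_small\<close>).

  Singular values and eigenvalues are specified by the dimensions of eigenspaces. What gives access
  to them is the spectral theorem for positive compact operators (\<open>eigval_spectral\<close>), applied to \<open>T\<close>
  and to the operators \<open>X\<^sup>* X\<close>; adjoints exist by \<open>riesz_representation\<close>.\<close>

section \<open>The geometry of a complex Hilbert space\<close>

lemma cinner_add_right: "cinner x (y + z) = cinner x y + cinner x z"
  by (metis cinner_add_left cinner_commute complex_cnj_add)

lemma cinner_scale_right: "cinner x (cscale c y) = cnj c * cinner x y"
  by (metis cinner_scale_left cinner_commute complex_cnj_mult)

lemma cinner_scaleR_left: "cinner (s *\<^sub>R x) y = complex_of_real s * cinner x y"
  by (metis cinner_scale_left cscale_of_real)

lemma cinner_scaleR_right: "cinner x (s *\<^sub>R y) = complex_of_real s * cinner x y"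
  by (metis cinner_scale_right cscale_of_real complex_cnj_complex_of_real)

lemma cinner_zero_left [simp]: "cinner 0 y = 0"
  using cinner_add_left[of 0 0 y] by simp

lemma cinner_zero_right [simp]: "cinner y 0 = 0"
  using cinner_add_right[of y 0 0] by simp

lemma cinner_minus_left: "cinner (- x) y = - cinner x y"
  using cinner_add_left[of x "- x" y] by (simp add: eq_neg_iff_add_eq_0 add.commute)

lemma cinner_minus_right: "cinner x (- y) = - cinner x y"
  using cinner_add_right[of x y "- y"] by (simp add: eq_neg_iff_add_eq_0 add.commute)

lemma cinner_diff_left: "cinner (x - y) z = cinner x z - cinner y z"
  using cinner_add_left[of x "- y" z] by (simp add: cinner_minus_left)

lemma cinner_diff_right: "cinner x (y - z) = cinner x y - cinner x z"
  using cinner_add_right[of x y "- z"] by (simp add: cinner_minus_right)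

lemma cinner_sum_left: "cinner (sum f A) y = (\<Sum>i\<in>A. cinner (f i) y)"
  by (induction A rule: infinite_finite_induct) (simp_all add: cinner_add_left)

lemma cinner_sum_right: "cinner y (sum f A) = (\<Sum>i\<in>A. cinner y (f i))"
  by (induction A rule: infinite_finite_induct) (simp_all add: cinner_add_right)

lemmas cinner_simps = cinner_add_left cinner_add_right cinner_diff_left cinner_diff_right
  cinner_scale_left cinner_scale_right cinner_scaleR_left cinner_scaleR_right

lemma Re_cinner_same: "Re (cinner x x) = (norm x)\<^sup>2"
  by (simp add: cinner_same)

lemma Re_cinner_commute: "Re (cinner x y) = Re (cinner y x)"
  by (metis cinner_commute cnj.simps(1))

lemma norm_cscale: "norm (cscale c x) = cmod c * norm x"
proof -
  have "complex_of_real ((norm (cscale c x))\<^sup>2) = complex_of_real ((cmod c * norm x)\<^sup>2)"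
    unfolding cinner_same[symmetric] cinner_scale_left cinner_scale_right mult.assoc[symmetric]
    by (simp add: cinner_same power_mult_distrib)
      (metis complex_norm_square mult.commute of_real_power)
  then show ?thesis
    by (simp only: of_real_eq_iff) (simp add: power2_eq_iff_nonneg)
qed

lemma norm_add_sq: "(norm (x + y))\<^sup>2 = (norm x)\<^sup>2 + (norm y)\<^sup>2 + 2 * Re (cinner x y)"
  using Re_cinner_commute[of y x] by (simp add: Re_cinner_same[symmetric] cinner_simps)

lemma norm_diff_sq: "(norm (x - y))\<^sup>2 = (norm x)\<^sup>2 + (norm y)\<^sup>2 - 2 * Re (cinner x y)"
  using Re_cinner_commute[of y x] by (simp add: Re_cinner_same[symmetric] cinner_simps)

lemma norm_residual_one_sq:
  assumes "y \<noteq> 0"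
  shows "(norm (x - cscale (cinner x y / complex_of_real ((norm y)\<^sup>2)) y))\<^sup>2
    = (norm x)\<^sup>2 - (cmod (cinner x y))\<^sup>2 / (norm y)\<^sup>2"
proof -
  define c where "c = cinner x y / complex_of_real ((norm y)\<^sup>2)"
  have c: "cmod c = cmod (cinner x y) / (norm y)\<^sup>2"
    by (simp add: c_def norm_divide norm_power)
  have re: "Re (cinner x (cscale c y)) = (cmod (cinner x y))\<^sup>2 / (norm y)\<^sup>2"
  proof -
    have "cinner x (cscale c y) = complex_of_real ((cmod (cinner x y))\<^sup>2 / (norm y)\<^sup>2)"
      unfolding c_def cinner_scale_right using complex_norm_square[of "cinner x y"]
      by (simp add: mult.commute)
    then show ?thesis by (metis Re_complex_of_real)
  qed
  show ?thesis
    unfolding c_def[symmetric] norm_diff_sq re norm_cscale c using assms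
    by (simp add: power_mult_distrib power_divide field_simps power2_eq_square)
qed

lemma cauchy_schwarz: "cmod (cinner x y) \<le> norm x * norm y"
proof (cases "y = 0")
  case False
  have "0 \<le> (norm x)\<^sup>2 - (cmod (cinner x y))\<^sup>2 / (norm y)\<^sup>2"
    unfolding norm_residual_one_sq[OF False, symmetric] by simp
  then have "(cmod (cinner x y))\<^sup>2 \<le> (norm x * norm y)\<^sup>2"
    using False by (simp add: field_simps power_mult_distrib)
  then show ?thesis by (simp add: power2_le_iff_abs_le)
qed simp

lemma Re_cinner_le: "Re (cinner x y) \<le> norm x * norm y"
  using complex_Re_le_cmod cauchy_schwarz order_trans by blast

lemma bounded_linear_cinner_left: "bounded_linear (\<lambda>x. cinner x y)"
  by (rule bounded_linear_intro[where K = "norm y"])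
    (simp_all add: cinner_simps scaleR_conv_of_real cauchy_schwarz)

lemma bounded_linear_cscale_right: "bounded_linear (\<lambda>x. cscale c x)"
  by (rule bounded_linear_intro[where K = "cmod c"])
    (simp_all add: cscale_add_right norm_cscale cscale_cscale mult.commute flip: cscale_of_real)

lemma bounded_linear_cscale_left: "bounded_linear (\<lambda>c. cscale c x)"
  by (rule bounded_linear_intro[where K = "norm x"])
    (simp_all add: cscale_add_left norm_cscale cscale_cscale scaleR_conv_of_real flip: cscale_of_real)

lemma cscale_zero_left [simp]: "cscale 0 x = 0"
  by (rule complex_vector.scale_zero_left)

lemma cscale_zero_right [simp]: "cscale c 0 = 0"
  by (rule complex_vector.scale_zero_right)

lemma cscale_one [simp]: "cscale 1 x = x"
  by (rule complex_vector.scale_one)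

lemma cinner_ext:
  assumes "\<And>x. cinner x y = cinner x z" shows "y = z"
  using assms[of "y - z"] cinner_same[of "y - z"] by (simp add: cinner_diff_right)

subsection \<open>Orthonormal sets and sequences\<close>

definition orthonormal_set :: "'a::complex_hilbert_space set \<Rightarrow> bool" where
  "orthonormal_set E \<longleftrightarrow> (\<forall>x\<in>E. \<forall>y\<in>E. cinner x y = (if x = y then 1 else 0))"

definition orthonormal_seq :: "(nat \<Rightarrow> 'a::complex_hilbert_space) \<Rightarrow> bool" where
  "orthonormal_seq u \<longleftrightarrow> (\<forall>i j. cinner (u i) (u j) = (if i = j then 1 else 0))"

lemma orthonormal_seqD: "orthonormal_seq u \<Longrightarrow> cinner (u i) (u j) = (if i = j then 1 else 0)"
  by (simp add: orthonormal_seq_def)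

lemma orthonormal_seq_inj: "orthonormal_seq u \<Longrightarrow> inj u"
  by (metis injI orthonormal_seqD zero_neq_one)

lemma orthonormal_seq_image: "orthonormal_seq u \<Longrightarrow> orthonormal_set (u ` A)"
  by (auto simp: orthonormal_set_def orthonormal_seqD dest: injD[OF orthonormal_seq_inj])

lemma orthonormal_seq_norm: "orthonormal_seq u \<Longrightarrow> norm (u j) = 1"
  using Re_cinner_same[of "u j"] norm_ge_zero[of "u j"] by (simp add: orthonormal_seqD power2_eq_1_iff)

lemma orthonormal_set_norm: "orthonormal_set E \<Longrightarrow> e \<in> E \<Longrightarrow> norm e = 1"
  using Re_cinner_same[of e] norm_ge_zero[of e] by (simp add: orthonormal_set_def power2_eq_1_iff)

text \<open>For finite orthonormal \<open>E\<close> this is the component of \<open>x\<close> orthogonal to the span of \<open>E\<close>.\<close>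

definition orth_residual :: "'a::complex_hilbert_space set \<Rightarrow> 'a \<Rightarrow> 'a" where
  "orth_residual E x = x - (\<Sum>e\<in>E. cscale (cinner x e) e)"

lemma cinner_orth_residual:
  assumes "finite E" "orthonormal_set E" "e \<in> E"
  shows "cinner (orth_residual E x) e = 0"
proof -
  have "cinner (\<Sum>f\<in>E. cscale (cinner x f) f) e = (\<Sum>f\<in>E. if f = e then cinner x f else 0)"
    unfolding cinner_sum_left cinner_scale_left
    using assms by (intro sum.cong) (auto simp: orthonormal_set_def)
  then show ?thesis using assms by (simp add: orth_residual_def cinner_diff_left)
qed

lemma orth_expansion_in_span:
  assumes "finite E" "orthonormal_set E" "x \<in> cspan E"
  shows "x = (\<Sum>e\<in>E. cscale (cinner x e) e)"
proof -
  define z where "z = orth_residual E x"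
  have zE: "cinner z e = 0" if "e \<in> E" for e
    using that assms by (simp add: z_def cinner_orth_residual)
  have z: "z \<in> cspan E"
    unfolding z_def orth_residual_def using assms(3)
    by (intro complex_vector.span_diff complex_vector.span_sum complex_vector.span_scale)
      (auto intro: complex_vector.span_base)
  have "cinner z w = 0" if "w \<in> cspan E" for w
    using that
    by (induction rule: complex_vector.span_induct_alt) (simp_all add: cinner_simps zE)
  from this[OF z] show ?thesis
    by (simp add: cinner_same z_def orth_residual_def)
qed

lemma pythagoras_residual:
  assumes "finite E" "orthonormal_set E"
  shows "(norm x)\<^sup>2 = (norm (orth_residual E x))\<^sup>2 + (\<Sum>e\<in>E. (cmod (cinner x e))\<^sup>2)"
proof -
  define p where "p = (\<Sum>e\<in>E. cscale (cinner x e) e)"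
  have zp: "cinner (orth_residual E x) p = 0"
    unfolding p_def cinner_sum_right cinner_scale_right by (simp add: cinner_orth_residual assms)
  have xe: "cinner p e = cinner x e" if "e \<in> E" for e
    using cinner_orth_residual[OF assms that, of x]
    by (simp add: orth_residual_def p_def cinner_diff_left)
  have "cinner p p = (\<Sum>e\<in>E. cinner p (cscale (cinner x e) e))"
    by (subst (2) p_def) (simp add: cinner_sum_right)
  also have "\<dots> = (\<Sum>e\<in>E. complex_of_real ((cmod (cinner x e))\<^sup>2))"
  proof (intro sum.cong refl)
    fix e assume "e \<in> E"
    then have "cinner p (cscale (cinner x e) e) = cinner x e * cnj (cinner x e)"
      by (simp add: cinner_scale_right xe mult.commute)
    then show "cinner p (cscale (cinner x e) e) = complex_of_real ((cmod (cinner x e))\<^sup>2)"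
      by (simp only: complex_norm_square)
  qed
  finally have "(norm p)\<^sup>2 = (\<Sum>e\<in>E. (cmod (cinner x e))\<^sup>2)"
    using Re_cinner_same[of p] by simp
  moreover have "x = orth_residual E x + p" by (simp add: orth_residual_def p_def)
  then have "(norm x)\<^sup>2 = (norm (orth_residual E x))\<^sup>2 + (norm p)\<^sup>2"
    by (metis norm_add_sq zp add.right_neutral mult_zero_right zero_complex.simps(1))
  ultimately show ?thesis by simp
qed

lemma norm_orth_residual_le:
  assumes "finite E" "orthonormal_set E"
  shows "norm (orth_residual E x) \<le> norm x"
proof -
  have "(norm (orth_residual E x))\<^sup>2 \<le> (norm x)\<^sup>2"
    unfolding pythagoras_residual[OF assms, of x] by (simp add: sum_nonneg)
  then show ?thesis by (simp add: power2_le_iff_abs_le)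
qed

lemma extend_orthonormal_one:
  assumes "finite E" "orthonormal_set E" "x \<notin> cspan E"
  obtains e where "e \<notin> E" "orthonormal_set (insert e E)" "x \<in> cspan (insert e E)"
    "norm e = 1" "\<forall>f\<in>E. cinner e f = 0"
proof -
  define z where "z = orth_residual E x"
  have p: "(\<Sum>e\<in>E. cscale (cinner x e) e) \<in> cspan E"
    by (intro complex_vector.span_sum complex_vector.span_scale complex_vector.span_base)
  have z0: "z \<noteq> 0" using assms(3) p by (auto simp: z_def orth_residual_def)
  define e where "e = inverse (norm z) *\<^sub>R z"
  have n: "norm e = 1" using z0 by (simp add: e_def)
  have orth: "cinner e f = 0" if "f \<in> E" for f
    using that assms by (simp add: e_def cinner_simps z_def cinner_orth_residual)
  have orth': "cinner f e = 0" if "f \<in> E" for f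
    using orth[OF that] by (metis cinner_commute complex_cnj_zero)
  have "e \<notin> E" using orth[of e] n cinner_same[of e] by auto
  moreover have "orthonormal_set (insert e E)"
    using assms(2) orth orth' n \<open>e \<notin> E\<close>
    unfolding orthonormal_set_def by (metis cinner_same insert_iff of_real_1 power_one)
  moreover have "x \<in> cspan (insert e E)"
  proof -
    have "z = cscale (complex_of_real (norm z)) e"
      using z0 by (simp add: e_def cscale_of_real)
    then have "z \<in> cspan (insert e E)"
      by (metis complex_vector.span_base complex_vector.span_scale insertI1)
    moreover have "(\<Sum>e\<in>E. cscale (cinner x e) e) \<in> cspan (insert e E)"
      using p complex_vector.span_mono[of E "insert e E"] by blast
    ultimately have "z + (\<Sum>e\<in>E. cscale (cinner x e) e) \<in> cspan (insert e E)"
      by (rule complex_vector.span_add)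
    then show ?thesis by (simp add: z_def orth_residual_def)
  qed
  ultimately show ?thesis using that n orth by blast
qed

lemma extend_orthonormal:
  assumes "finite E" "orthonormal_set E" "finite X"
  shows "\<exists>E'. E \<subseteq> E' \<and> finite E' \<and> orthonormal_set E' \<and> X \<subseteq> cspan E' \<and> card E' \<le> card E + card X"
  using assms(3)
proof (induction X)
  case empty
  then show ?case using assms by auto
next
  case (insert x X)
  then obtain E' where E': "E \<subseteq> E'" "finite E'" "orthonormal_set E'" "X \<subseteq> cspan E'"
    "card E' \<le> card E + card X" by auto
  show ?case
  proof (cases "x \<in> cspan E'")
    case True
    then show ?thesis using E' insert by (intro exI[of _ E']) auto
  next
    case False
    from extend_orthonormal_one[OF E'(2,3) False]
    obtain e where "e \<notin> E'" "orthonormal_set (insert e E')" "x \<in> cspan (insert e E')" by metis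
    moreover have "cspan E' \<subseteq> cspan (insert e E')" by (intro complex_vector.span_mono) auto
    ultimately show ?thesis using E' insert by (intro exI[of _ "insert e E'"]) auto
  qed
qed

section \<open>Bounded operators, adjoints and compactness\<close>

lemma bounded_op_add: "bounded_op A \<Longrightarrow> A (x + y) = A x + A y"
  by (simp add: bounded_op_def bounded_linear.linear linear_add)

lemma bounded_op_diff: "bounded_op A \<Longrightarrow> A (x - y) = A x - A y"
  by (simp add: bounded_op_def bounded_linear.linear linear_diff)

lemma bounded_op_zero: "bounded_op A \<Longrightarrow> A 0 = 0"
  by (simp add: bounded_op_def bounded_linear.linear linear_0)

lemma bounded_op_sum: "bounded_op A \<Longrightarrow> A (sum f I) = (\<Sum>i\<in>I. A (f i))"
  by (simp add: bounded_op_def bounded_linear.linear linear_sum)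

lemma bounded_op_cscale: "bounded_op A \<Longrightarrow> A (cscale c x) = cscale c (A x)"
  by (simp add: bounded_op_def)

lemma bounded_op_scaleR: "bounded_op A \<Longrightarrow> A (s *\<^sub>R x) = s *\<^sub>R A x"
  by (simp add: bounded_op_def bounded_linear.linear linear_scale)

lemma bounded_op_bound:
  assumes "bounded_op A" obtains K where "K > 0" "\<And>x. norm (A x) \<le> K * norm x"
  using assms bounded_linear.pos_bounded[of A] by (auto simp: bounded_op_def mult.commute)

lemma bounded_op_compose: "bounded_op A \<Longrightarrow> bounded_op B \<Longrightarrow> bounded_op (A \<circ> B)"
  using bounded_linear_compose[of A B] by (simp add: bounded_op_def o_def)

lemma bounded_opI:
  assumes "\<And>x y. A (x + y) = A x + A y" "\<And>c x. A (cscale c x) = cscale c (A x)"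
    "\<And>x. norm (A x) \<le> K * norm x"
  shows "bounded_op A"
proof -
  have "A (s *\<^sub>R x) = s *\<^sub>R A x" for s x using assms(2)[of "complex_of_real s" x] by (simp add: cscale_of_real)
  then have "bounded_linear A"
    using assms by (intro bounded_linear_intro[where K = K]) (auto simp: mult.commute)
  then show ?thesis using assms by (simp add: bounded_op_def)
qed

subsection \<open>The Riesz representation theorem and adjoints\<close>

text \<open>A minimising sequence for the norm on the affine hyperplane \<open>f = 1\<close> is Cauchy by the
  parallelogram law; its limit is orthogonal to the kernel of \<open>f\<close> and therefore represents \<open>f\<close>
  up to a scalar.\<close>

lemma riesz_representation:
  fixes f :: "'a::complex_hilbert_space \<Rightarrow> complex"
  assumes f: "bounded_linear f" and fc: "\<And>c x. f (cscale c x) = c * f x"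
  shows "\<exists>z. \<forall>x. f x = cinner x z"
proof (cases "\<forall>x. f x = 0")
  case True
  then show ?thesis by (intro exI[of _ 0]) simp
next
  case False
  then obtain w where w: "f w \<noteq> 0" by blast
  have lin: "linear f" using f by (rule bounded_linear.linear)
  define C where "C = {x. f x = 1}"
  define d where "d = Inf ((\<lambda>x. (norm x)\<^sup>2) ` C)"
  have "cscale (1 / f w) w \<in> C" using w by (simp add: C_def fc)
  then have ne: "(\<lambda>x. (norm x)\<^sup>2) ` C \<noteq> {}" by blast
  have bdd: "bdd_below ((\<lambda>x. (norm x)\<^sup>2) ` C)" by (intro bdd_belowI[of _ 0]) auto
  have dle: "d \<le> (norm x)\<^sup>2" if "x \<in> C" for x
    unfolding d_def using bdd that by (intro cInf_lower) auto
  have "\<exists>x\<in>C. (norm x)\<^sup>2 < d + 1 / (real n + 1)" for n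
  proof -
    have "d < d + 1 / (real n + 1)" by simp
    then show ?thesis using cInf_lessD[OF ne] unfolding d_def by blast
  qed
  then obtain X where X: "\<And>n. X n \<in> C" "\<And>n. (norm (X n))\<^sup>2 < d + 1 / (real n + 1)" by metis
  have close: "(norm (X m - X n))\<^sup>2 \<le> 2 * (1 / (real m + 1)) + 2 * (1 / (real n + 1))" for m n
  proof -
    have "(1/2) *\<^sub>R (X m + X n) \<in> C"
      using X(1)[of m] X(1)[of n]
      by (simp add: C_def linear_scale[OF lin] linear_add[OF lin] scaleR_conv_of_real)
    from dle[OF this] have "4 * d \<le> (norm (X m + X n))\<^sup>2" by (simp add: power_divide)
    moreover have "(norm (X m - X n))\<^sup>2 + (norm (X m + X n))\<^sup>2 = 2 * (norm (X m))\<^sup>2 + 2 * (norm (X n))\<^sup>2"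
      by (simp add: norm_diff_sq norm_add_sq)
    ultimately show ?thesis using X(2)[of m] X(2)[of n] by linarith
  qed
  have "Cauchy X"
  proof (rule metric_CauchyI)
    fix e :: real assume e: "e > 0"
    obtain N where N: "real N > 4 / e\<^sup>2" using reals_Archimedean2 by blast
    have bnd: "2 * (1 / (real m + 1)) < e\<^sup>2 / 2" if "m \<ge> N" for m
    proof -
      have "real m + 1 > 4 / e\<^sup>2" using N that by linarith
      then show ?thesis using e by (simp add: field_simps)
    qed
    have "dist (X m) (X n) < e" if "m \<ge> N" "n \<ge> N" for m n
    proof -
      have "(norm (X m - X n))\<^sup>2 < e\<^sup>2"
        using close[of m n] bnd[OF that(1)] bnd[OF that(2)] by linarith
      then show ?thesis using e by (simp add: dist_norm power2_less_imp_less)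
    qed
    then show "\<exists>M. \<forall>m\<ge>M. \<forall>n\<ge>M. dist (X m) (X n) < e" by blast
  qed
  then obtain y where y: "X \<longlonglongrightarrow> y" using Cauchy_convergent convergent_def by blast
  have "(\<lambda>n. f (X n)) \<longlonglongrightarrow> f y" by (rule bounded_linear.tendsto[OF f y])
  moreover have "(\<lambda>n. f (X n)) = (\<lambda>n. 1)" using X(1) by (simp add: C_def)
  ultimately have fy: "f y = 1" by (simp add: LIMSEQ_const_iff)
  then have y0: "y \<noteq> 0" using linear_0[OF lin] by auto
  have ny: "(norm y)\<^sup>2 \<le> d"
  proof (rule LIMSEQ_le)
    show "(\<lambda>n. (norm (X n))\<^sup>2) \<longlonglongrightarrow> (norm y)\<^sup>2" by (intro tendsto_intros y)
    show "(\<lambda>n. d + 1 / (real n + 1)) \<longlonglongrightarrow> d"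
      using tendsto_add[OF tendsto_const[of d] LIMSEQ_inverse_real_of_nat]
      by (simp add: inverse_eq_divide add.commute)
    show "\<exists>N. \<forall>n\<ge>N. (norm (X n))\<^sup>2 \<le> d + 1 / (real n + 1)" using X(2) less_imp_le by blast
  qed
  have orth: "cinner x y = 0" if x: "f x = 0" for x
  proof (rule ccontr)
    assume ne: "cinner x y \<noteq> 0"
    then have x0: "x \<noteq> 0" by auto
    define c where "c = cinner y x / complex_of_real ((norm x)\<^sup>2)"
    have yx: "cinner y x = cnj (cinner x y)" by (rule cinner_commute)
    have "f (y - cscale c x) = 1" by (simp add: linear_diff[OF lin] fc x fy)
    then have "d \<le> (norm (y - cscale c x))\<^sup>2" by (intro dle) (simp add: C_def)
    also have "\<dots> = (norm y)\<^sup>2 - (cmod (cinner x y))\<^sup>2 / (norm x)\<^sup>2"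
      unfolding c_def norm_residual_one_sq[OF x0] by (simp add: yx)
    also have "\<dots> < (norm y)\<^sup>2" using ne x0 by simp
    finally show False using ny by linarith
  qed
  have "f x = cinner x (cscale (1 / complex_of_real ((norm y)\<^sup>2)) y)" for x
  proof -
    have "f (x - cscale (f x) y) = 0" by (simp add: linear_diff[OF lin] fc fy)
    from orth[OF this] have "cinner x y = f x * complex_of_real ((norm y)\<^sup>2)"
      by (simp add: cinner_simps cinner_same)
    then show ?thesis using y0 by (simp add: cinner_scale_right)
  qed
  then show ?thesis by blast
qed

lemma adjoint_op_unique:
  assumes "\<And>x y. cinner (A x) y = cinner x (B y)"
  shows "adjoint_op A = B"
  unfolding adjoint_op_def
proof (rule the_equality)
  fix S assume "\<forall>x y. cinner (A x) y = cinner x (S y)"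
  then show "S = B" using assms by (intro ext cinner_ext) metis
qed (use assms in blast)

lemma adjoint_op:
  assumes "bounded_op A"
  shows "cinner (A x) y = cinner x (adjoint_op A y)"
proof -
  have "\<exists>z. \<forall>x. cinner (A x) y = cinner x z" for y
  proof (rule riesz_representation)
    show "bounded_linear (\<lambda>x. cinner (A x) y)"
      using assms bounded_linear_compose[OF bounded_linear_cinner_left[of y], of A]
      by (simp add: bounded_op_def)
    show "cinner (A (cscale c x)) y = c * cinner (A x) y" for c x
      using assms by (simp add: bounded_op_cscale cinner_scale_left)
  qed
  then obtain S where S: "\<And>x y. cinner (A x) y = cinner x (S y)" by metis
  then show ?thesis using adjoint_op_unique[of A S] by metis
qed

lemma adjoint_op_swap:
  assumes "bounded_op A"
  shows "cinner (adjoint_op A x) y = cinner x (A y)"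
  by (metis adjoint_op[OF assms] cinner_commute)

lemma bounded_op_adjoint:
  assumes A: "bounded_op A" shows "bounded_op (adjoint_op A)"
proof -
  obtain K where K: "K > 0" "\<And>x. norm (A x) \<le> K * norm x" using bounded_op_bound[OF A] by blast
  show ?thesis
  proof (rule bounded_opI)
    show "adjoint_op A (x + y) = adjoint_op A x + adjoint_op A y" for x y
      by (rule cinner_ext) (simp add: adjoint_op[OF A, symmetric] cinner_add_right)
    show "adjoint_op A (cscale c x) = cscale c (adjoint_op A x)" for c x
      by (rule cinner_ext) (simp add: adjoint_op[OF A, symmetric] cinner_scale_right)
    show "norm (adjoint_op A y) \<le> K * norm y" for y
    proof -
      define z where "z = adjoint_op A y"
      have "(norm z)\<^sup>2 = Re (cinner (A z) y)"
        unfolding adjoint_op[OF A] by (simp add: z_def Re_cinner_same)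
      also have "\<dots> \<le> norm (A z) * norm y" by (rule Re_cinner_le)
      also have "\<dots> \<le> K * norm z * norm y" using K by (intro mult_right_mono) auto
      finally have "norm z * norm z \<le> norm z * (K * norm y)" by (simp add: power2_eq_square mult_ac)
      then show ?thesis using K(1)
        by (cases "norm z = 0") (auto simp: z_def[symmetric])
    qed
  qed
qed

subsection \<open>Compact operators\<close>

lemma compact_op_subseq:
  assumes "compact_op A" "\<And>n. norm (x n) \<le> 1"
  obtains s y where "strict_mono (s :: nat \<Rightarrow> nat)" "(\<lambda>n. A (x (s n))) \<longlonglongrightarrow> y"
proof -
  have "compact (closure (A ` cball 0 1))" using assms(1) by (simp add: compact_op_def)
  moreover have "\<forall>n. A (x n) \<in> closure (A ` cball 0 1)"
    using assms(2) closure_subset by (fastforce simp: dist_norm)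
  ultimately have "\<exists>l\<in>closure (A ` cball 0 1). \<exists>s. strict_mono (s :: nat \<Rightarrow> nat) \<and> ((\<lambda>n. A (x n)) \<circ> s) \<longlonglongrightarrow> l"
    unfolding compact_def by (auto dest!: spec[of _ "\<lambda>n. A (x n)"])
  then show ?thesis using that by (auto simp: o_def)
qed

lemma compact_op_compose_left:
  assumes "bounded_op B" "compact_op A"
  shows "compact_op (B \<circ> A)"
proof -
  have cpt: "compact (B ` closure (A ` cball 0 1))"
    using assms linear_continuous_on
    by (intro compact_continuous_image) (auto simp: compact_op_def bounded_op_def)
  moreover have "(B \<circ> A) ` cball 0 1 \<subseteq> B ` closure (A ` cball 0 1)"
    unfolding image_comp[symmetric] by (intro image_mono closure_subset)
  ultimately have sub: "closure ((B \<circ> A) ` cball 0 1) \<subseteq> B ` closure (A ` cball 0 1)"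
    by (intro closure_minimal compact_imp_closed)
  have "compact (B ` closure (A ` cball 0 1) \<inter> closure ((B \<circ> A) ` cball 0 1))"
    by (intro compact_Int_closed cpt closed_closure)
  then have "compact (closure ((B \<circ> A) ` cball 0 1))"
    using sub by (simp add: inf.absorb2)
  then show ?thesis using assms bounded_op_compose by (auto simp: compact_op_def)
qed

lemma compact_closure_of_totally_bounded:
  fixes S :: "'a::banach set"
  assumes "\<And>e. e > 0 \<Longrightarrow> \<exists>K. compact K \<and> (\<forall>x\<in>S. \<exists>y\<in>K. dist x y \<le> e)"
  shows "compact (closure S)"
  unfolding compact_eq_totally_bounded
proof (intro conjI allI impI)
  show "complete (closure S)" by (simp add: complete_eq_closed)
  fix e :: real assume e: "e > 0"
  then obtain K where K: "compact K" "\<forall>x\<in>S. \<exists>y\<in>K. dist x y \<le> e / 4"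
    using assms[of "e / 4"] by force
  obtain k where k: "finite k" "K \<subseteq> (\<Union>x\<in>k. ball x (e / 4))"
    using K(1) e unfolding compact_eq_totally_bounded by (auto dest!: spec[of _ "e / 4"])
  have "closure S \<subseteq> (\<Union>x\<in>k. ball x e)"
  proof
    fix x assume "x \<in> closure S"
    then obtain z where z: "z \<in> S" "dist z x < e / 4"
      using e unfolding closure_approachable by (auto dest!: spec[of _ "e / 4"])
    then obtain y where y: "y \<in> K" "dist z y \<le> e / 4" using K by blast
    then obtain c where c: "c \<in> k" "dist c y < e / 4" using k by auto
    have "dist c x \<le> dist c y + dist y x" "dist y x \<le> dist z y + dist z x"
      by (rule dist_triangle, rule dist_triangle3)
    then have "dist c x < e" using z y c e by linarith
    then show "x \<in> (\<Union>x\<in>k. ball x e)" using c by auto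
  qed
  then show "\<exists>k. finite k \<and> closure S \<subseteq> (\<Union>x\<in>k. ball x e)" using k(1) by blast
qed

lemma compact_box_in_span:
  fixes v :: "nat \<Rightarrow> 'a::complex_hilbert_space"
  assumes "0 \<le> B"
  shows "compact {\<Sum>i<n. cscale (c i) (v i) | c. \<forall>i. cmod (c i) \<le> B}"
proof (induction n)
  case 0
  have "{\<Sum>i<0. cscale (c i) (v i) | c. \<forall>i. cmod (c i) \<le> B} = {0}"
    using assms by (auto intro: exI[of _ "\<lambda>_. 0"])
  then show ?case by simp
next
  case (Suc n)
  let ?K = "\<lambda>n. {\<Sum>i<n. cscale (c i) (v i) | c. \<forall>i. cmod (c i) \<le> B}"
  let ?L = "(\<lambda>c. cscale c (v n)) ` cball 0 B"
  have "compact ?L"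
    by (intro compact_continuous_image linear_continuous_on bounded_linear_cscale_left) simp
  then have "compact {x + y | x y. x \<in> ?K n \<and> y \<in> ?L}" using Suc.IH by (intro compact_sums)
  moreover have "{x + y | x y. x \<in> ?K n \<and> y \<in> ?L} = ?K (Suc n)"
  proof (intro set_eqI iffI)
    fix z assume "z \<in> {x + y | x y. x \<in> ?K n \<and> y \<in> ?L}"
    then obtain c d where cd: "\<forall>i. cmod (c i) \<le> B" "cmod d \<le> B"
      "z = (\<Sum>i<n. cscale (c i) (v i)) + cscale d (v n)" by (auto simp: dist_norm)
    have "z = (\<Sum>i<Suc n. cscale ((c(n := d)) i) (v i))" using cd(3) by simp
    moreover have "\<forall>i. cmod ((c(n := d)) i) \<le> B" using cd by simp
    ultimately show "z \<in> ?K (Suc n)" by blast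
  next
    fix z assume "z \<in> ?K (Suc n)"
    then obtain c where c: "\<forall>i. cmod (c i) \<le> B" "z = (\<Sum>i<Suc n. cscale (c i) (v i))" by blast
    have "(\<Sum>i<n. cscale (c i) (v i)) \<in> ?K n" using c by blast
    moreover have "cscale (c n) (v n) \<in> ?L" using c by auto
    ultimately show "z \<in> {x + y | x y. x \<in> ?K n \<and> y \<in> ?L}" using c(2) by auto
  qed
  ultimately show ?case by simp
qed

subsection \<open>Operators that are diagonal between two orthonormal sequences\<close>

lemma norm_sum_orthonormal:
  assumes "orthonormal_seq v" "finite A"
  shows "(norm (\<Sum>i\<in>A. cscale (c i) (v i)))\<^sup>2 = (\<Sum>i\<in>A. (cmod (c i))\<^sup>2)"
  using assms(2)
proof (induction A)
  case (insert k A)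
  have "cinner (\<Sum>i\<in>A. cscale (c i) (v i)) (cscale (c k) (v k)) = 0"
    unfolding cinner_sum_left using insert(2)
    by (intro sum.neutral) (auto simp: cinner_simps orthonormal_seqD[OF assms(1)])
  then show ?case
    using insert by (simp add: norm_add_sq add.commute[of "cscale (c k) (v k)"] norm_cscale
        orthonormal_seq_norm[OF assms(1)])
qed simp

lemma bessel_sum:
  assumes "orthonormal_seq u" "finite A"
  shows "(\<Sum>i\<in>A. (cmod (cinner x (u i)))\<^sup>2) \<le> (norm x)\<^sup>2"
proof -
  have "(\<Sum>e\<in>u ` A. (cmod (cinner x e))\<^sup>2) \<le> (norm x)\<^sup>2"
    unfolding pythagoras_residual[OF finite_imageI[OF assms(2)] orthonormal_seq_image[OF assms(1)], of x]
    by simp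
  moreover have "inj_on u A" using orthonormal_seq_inj[OF assms(1)] by (rule inj_on_subset) simp
  ultimately show ?thesis by (simp add: sum.reindex)
qed

lemma bessel_summable:
  assumes "orthonormal_seq u"
  shows "summable (\<lambda>i. (cmod (cinner x (u i)))\<^sup>2)"
  by (rule summableI_nonneg_bounded[where x = "(norm x)\<^sup>2"]) (auto intro: bessel_sum assms)

definition series_op :: "(nat \<Rightarrow> real) \<Rightarrow> (nat \<Rightarrow> 'a) \<Rightarrow> (nat \<Rightarrow> 'a) \<Rightarrow> 'a \<Rightarrow> 'a::complex_hilbert_space" where
  "series_op a u v x = (\<Sum>j. cscale (complex_of_real (a j) * cinner x (u j)) (v j))"

text \<open>Only the coefficients at indices with \<open>\<langle>x, u j\<rangle> \<noteq> 0\<close> matter for the bound, which therefore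
  gives boundedness as well as the smallness of the operator on the complement of
  \<open>u 0, \<dots>, u (n - 1)\<close>.\<close>

lemma series_op_bound:
  assumes u: "orthonormal_seq u" and v: "orthonormal_seq v"
    and B: "\<And>j. cinner x (u j) = 0 \<or> \<bar>a j\<bar> \<le> B" "0 \<le> B"
  shows series_op_summable: "summable (\<lambda>j. cscale (complex_of_real (a j) * cinner x (u j)) (v j))"
    and norm_series_op_le: "norm (series_op a u v x) \<le> B * norm x"
proof -
  define t where "t j = cscale (complex_of_real (a j) * cinner x (u j)) (v j)" for j
  have fin: "(norm (sum t A))\<^sup>2 \<le> B\<^sup>2 * (\<Sum>j\<in>A. (cmod (cinner x (u j)))\<^sup>2)" if "finite A" for A
  proof -
    have "(norm (sum t A))\<^sup>2 = (\<Sum>j\<in>A. (cmod (complex_of_real (a j) * cinner x (u j)))\<^sup>2)"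
      unfolding t_def by (rule norm_sum_orthonormal[OF v that])
    also have "\<dots> \<le> (\<Sum>j\<in>A. B\<^sup>2 * (cmod (cinner x (u j)))\<^sup>2)"
    proof (rule sum_mono)
      fix j show "(cmod (complex_of_real (a j) * cinner x (u j)))\<^sup>2 \<le> B\<^sup>2 * (cmod (cinner x (u j)))\<^sup>2"
      proof (cases "cinner x (u j) = 0")
        case False
        then have "(a j)\<^sup>2 \<le> B\<^sup>2" using B(1)[of j] B(2) by (simp add: abs_le_square_iff[symmetric])
        then show ?thesis by (simp add: norm_mult power_mult_distrib mult_right_mono)
      qed simp
    qed
    finally show ?thesis by (simp add: sum_distrib_left)
  qed
  show sm: "summable (\<lambda>j. cscale (complex_of_real (a j) * cinner x (u j)) (v j))"
    unfolding t_def[symmetric] summable_Cauchy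
  proof (intro allI impI)
    fix e :: real assume e: "e > 0"
    \<comment> \<open>The denominator is \<open>B + 1\<close> because \<open>B\<close> may be \<open>0\<close>.\<close>
    then have "(e / (B + 1))\<^sup>2 > 0" using B(2) by simp
    then obtain N where N: "\<And>m n. m \<ge> N \<Longrightarrow>
        norm (\<Sum>j=m..<n. (cmod (cinner x (u j)))\<^sup>2) < (e / (B + 1))\<^sup>2"
      using bessel_summable[OF u, of x] unfolding summable_Cauchy by meson
    have "norm (sum t {m..<n}) < e" if "m \<ge> N" for m n
    proof -
      have "(norm (sum t {m..<n}))\<^sup>2 \<le> B\<^sup>2 * (\<Sum>j=m..<n. (cmod (cinner x (u j)))\<^sup>2)"
        by (rule fin) simp
      also have "\<dots> \<le> (B + 1)\<^sup>2 * (\<Sum>j=m..<n. (cmod (cinner x (u j)))\<^sup>2)"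
        using B(2) by (intro mult_right_mono power_mono sum_nonneg) auto
      also have "\<dots> < (B + 1)\<^sup>2 * (e / (B + 1))\<^sup>2"
        using N[OF that, of n] B(2) by (intro mult_strict_left_mono) auto
      also have "\<dots> = e\<^sup>2" using B(2) by (simp add: power_divide)
      finally show ?thesis using e by (simp add: power2_less_imp_less)
    qed
    then show "\<exists>N. \<forall>m\<ge>N. \<forall>n. norm (sum t {m..<n}) < e" by blast
  qed
  have "norm (sum t {..<n}) \<le> B * norm x" for n
  proof -
    have "(norm (sum t {..<n}))\<^sup>2 \<le> B\<^sup>2 * (\<Sum>j<n. (cmod (cinner x (u j)))\<^sup>2)"
      by (rule fin) simp
    also have "\<dots> \<le> B\<^sup>2 * (norm x)\<^sup>2" by (intro mult_left_mono bessel_sum[OF u]) auto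
    finally have "(norm (sum t {..<n}))\<^sup>2 \<le> (B * norm x)\<^sup>2" by (simp add: power_mult_distrib)
    then show ?thesis using B(2) by (simp add: power2_le_iff_abs_le)
  qed
  moreover have "(\<lambda>n. norm (sum t {..<n})) \<longlonglongrightarrow> norm (series_op a u v x)"
    unfolding series_op_def t_def using sm by (intro tendsto_norm summable_LIMSEQ)
  ultimately show "norm (series_op a u v x) \<le> B * norm x"
    by (intro LIMSEQ_le_const2) auto
qed

context
  fixes a :: "nat \<Rightarrow> real" and u v :: "nat \<Rightarrow> 'a::complex_hilbert_space" and B :: real
  assumes u: "orthonormal_seq u" and v: "orthonormal_seq v" and B: "\<And>j. \<bar>a j\<bar> \<le> B"
begin

lemma series_op_summable_bdd: "summable (\<lambda>j. cscale (complex_of_real (a j) * cinner x (u j)) (v j))"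
  using B order_trans[OF abs_ge_zero B] by (intro series_op_summable[OF u v, of _ _ B]) auto

lemma cinner_series_op:
  "(\<lambda>j. complex_of_real (a j) * cinner x (u j) * cinner (v j) y) sums cinner (series_op a u v x) y"
proof -
  have "(\<lambda>j. cinner (cscale (complex_of_real (a j) * cinner x (u j)) (v j)) y) sums
      cinner (series_op a u v x) y"
    unfolding series_op_def
    by (intro bounded_linear.sums[OF bounded_linear_cinner_left] summable_sums series_op_summable_bdd)
  then show ?thesis by (simp add: cinner_scale_left)
qed

lemma cinner_series_op_basis: "cinner (series_op a u v x) (v k) = complex_of_real (a k) * cinner x (u k)"
proof -
  have "(\<lambda>j. if j = k then complex_of_real (a j) * cinner x (u j) else 0) sums
      cinner (series_op a u v x) (v k)"
    using cinner_series_op[of x "v k"] by (rule sums_cong[THEN iffD1, rotated]) (auto simp: orthonormal_seqD[OF v])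
  from sums_unique2[OF this sums_single] show ?thesis .
qed

lemma series_op_basis: "series_op a u v (u k) = a k *\<^sub>R v k"
proof -
  have "(\<lambda>j. if j = k then cscale (complex_of_real (a j)) (v j) else 0) sums
      series_op a u v (u k)"
    unfolding series_op_def
    by (rule sums_cong[THEN iffD1, OF _ summable_sums[OF series_op_summable_bdd]])
      (auto simp: orthonormal_seqD[OF u])
  from sums_unique2[OF this sums_single] show ?thesis by (simp only: cscale_of_real)
qed

lemma bounded_op_series_op: "bounded_op (series_op a u v)"
proof (rule bounded_opI)
  show "series_op a u v (x + y) = series_op a u v x + series_op a u v y" for x y
    unfolding series_op_def
    by (simp add: cinner_add_left distrib_left cscale_add_left suminf_add series_op_summable_bdd)
  show "series_op a u v (cscale c x) = cscale c (series_op a u v x)" for c x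
    unfolding series_op_def
    by (simp add: cinner_scale_left cscale_cscale mult.left_commute series_op_summable_bdd
        bounded_linear.suminf[OF bounded_linear_cscale_right])
  show "norm (series_op a u v x) \<le> B * norm x" for x
    using B order_trans[OF abs_ge_zero B] by (intro norm_series_op_le[OF u v]) auto
qed

lemma compact_op_series_op:
  assumes a0: "a \<longlonglongrightarrow> 0"
  shows "compact_op (series_op a u v)"
proof -
  have B0: "0 \<le> B" using order_trans[OF abs_ge_zero B] .
  have "compact (closure (series_op a u v ` cball 0 1))"
  proof (rule compact_closure_of_totally_bounded)
    fix e :: real assume e: "e > 0"
    then obtain n where n: "\<And>j. j \<ge> n \<Longrightarrow> \<bar>a j\<bar> < e"
      using a0 unfolding LIMSEQ_iff by auto
    let ?K = "{\<Sum>i<n. cscale (c i) (v i) | c. \<forall>i. cmod (c i) \<le> B}"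
    have "\<exists>y\<in>?K. dist z y \<le> e" if z: "z \<in> series_op a u v ` cball 0 1" for z
    proof -
      obtain x where x: "norm x \<le> 1" "z = series_op a u v x" using z by auto
      define c where "c j = complex_of_real (a j) * cinner x (u j)" for j
      have "cmod (c j) \<le> B" for j
      proof -
        have "cmod (cinner x (u j)) \<le> 1"
          using cauchy_schwarz[of x "u j"] x(1) orthonormal_seq_norm[OF u, of j] by simp
        then have "cmod (c j) \<le> B * 1" unfolding c_def norm_mult using B[of j] B0
          by (intro mult_mono) auto
        then show ?thesis by simp
      qed
      then have inK: "(\<Sum>i<n. cscale (c i) (v i)) \<in> ?K" by blast
      have us: "orthonormal_seq (\<lambda>j. u (j + n))" "orthonormal_seq (\<lambda>j. v (j + n))"
        using u v by (simp_all add: orthonormal_seq_def)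
      have "z - (\<Sum>i<n. cscale (c i) (v i)) = series_op (\<lambda>j. a (j + n)) (\<lambda>j. u (j + n)) (\<lambda>j. v (j + n)) x"
        unfolding x(2) series_op_def c_def
        using suminf_minus_initial_segment[OF series_op_summable_bdd[of x], of n] by simp
      also have "norm \<dots> \<le> e * norm x"
        using n e by (intro norm_series_op_le[OF us]) (auto simp: less_imp_le)
      also have "\<dots> \<le> e" using x(1) e by (simp add: mult_left_le)
      finally show ?thesis using inK unfolding dist_norm by blast
    qed
    then show "\<exists>K. compact K \<and> (\<forall>x\<in>series_op a u v ` cball 0 1. \<exists>y\<in>K. dist x y \<le> e)"
      using compact_box_in_span[OF B0] by blast
  qed
  then show ?thesis using bounded_op_series_op by (simp add: compact_op_def)
qed

end

lemma adjoint_series_op: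
  assumes u: "orthonormal_seq u" and v: "orthonormal_seq v" and B: "\<And>j. \<bar>a j\<bar> \<le> B"
  shows "adjoint_op (series_op a u v) = series_op a v u"
proof (rule adjoint_op_unique)
  fix x y
  have "(\<lambda>j. cnj (complex_of_real (a j) * cinner y (v j) * cinner (u j) x)) sums
      cnj (cinner (series_op a v u y) x)"
    unfolding sums_cnj by (rule cinner_series_op[OF v u B])
  also have "(\<lambda>j. cnj (complex_of_real (a j) * cinner y (v j) * cinner (u j) x)) = (\<lambda>j.
      complex_of_real (a j) * cinner x (u j) * cinner (v j) y)"
    by (intro ext) (simp add: cinner_commute[of y] cinner_commute[of "u _"] mult_ac)
  finally have "cinner (series_op a u v x) y = cnj (cinner (series_op a v u y) x)"
    by (rule sums_unique2[OF cinner_series_op[OF u v B]])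
  then show "cinner (series_op a u v x) y = cinner x (series_op a v u y)"
    by (metis cinner_commute)
qed

lemma series_op_comp:
  assumes u: "orthonormal_seq u" and v: "orthonormal_seq v" and B: "\<And>j. \<bar>a j\<bar> \<le> B"
  shows "series_op b v w (series_op a u v x) = series_op (\<lambda>j. b j * a j) u w x"
  unfolding series_op_def[of b] series_op_def[of "\<lambda>j. b j * a j"] cinner_series_op_basis[OF u v B]
  by (simp add: mult.assoc)

section \<open>The spectral theorem for positive compact operators\<close>

lemma positive_op_Re: "positive_op P \<Longrightarrow> 0 \<le> Re (cinner (P x) x)"
  by (simp add: positive_op_def complex_nonneg_Reals_iff)

text \<open>Polarisation: the imaginary part of the form vanishes at \<open>x + y\<close> and at \<open>x + \<i> y\<close>.\<close>

lemma positive_op_selfadjoint: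
  assumes "positive_op P"
  shows "cinner (P x) y = cinner x (P y)"
proof -
  have P: "bounded_op P" using assms by (simp add: positive_op_def)
  have Im: "Im (cinner (P z) z) = 0" for z
    using assms by (simp add: positive_op_def complex_nonneg_Reals_iff)
  have "Im (cinner (P x) y) + Im (cinner (P y) x) = 0"
    using Im[of "x + y"] Im[of x] Im[of y] by (simp add: bounded_op_add[OF P] cinner_simps)
  moreover have "Re (cinner (P y) x) - Re (cinner (P x) y) = 0"
    using Im[of "x + cscale \<i> y"] Im[of x] Im[of y]
    by (simp add: bounded_op_add[OF P] bounded_op_cscale[OF P] cinner_simps)
  ultimately have "cinner (P x) y = cnj (cinner (P y) x)" by (simp add: complex_eq_iff)
  then show ?thesis by (metis cinner_commute)
qed

text \<open>A substitute for the Cauchy--Schwarz inequality of the form \<open>\<langle>P x, y\<rangle>\<close>: evaluate the form at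
  \<open>y - t P y\<close> for the best real \<open>t\<close>.\<close>

lemma norm_sq_le_form:
  assumes "positive_op P" "0 \<le> l" "Re (cinner (P y) y) \<le> l * (norm y)\<^sup>2"
    "Re (cinner (P (P y)) (P y)) \<le> l * (norm (P y))\<^sup>2"
  shows "(norm (P y))\<^sup>2 \<le> l * Re (cinner (P y) y)"
proof -
  have P: "bounded_op P" using assms by (simp add: positive_op_def)
  have *: "0 \<le> Re (cinner (P y) y) - 2 * t * (norm (P y))\<^sup>2 + t\<^sup>2 * (l * (norm (P y))\<^sup>2)" for t
  proof -
    have "0 \<le> Re (cinner (P (y - t *\<^sub>R P y)) (y - t *\<^sub>R P y))" by (rule positive_op_Re[OF assms(1)])
    also have "\<dots> = Re (cinner (P y) y) - 2 * t * (norm (P y))\<^sup>2 + t\<^sup>2 * Re (cinner (P (P y)) (P y))"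
      using positive_op_selfadjoint[OF assms(1), of "P y" y] Re_cinner_same[of "P y"]
      by (simp add: bounded_op_diff[OF P] bounded_op_scaleR[OF P] cinner_simps power2_eq_square algebra_simps)
    also have "\<dots> \<le> Re (cinner (P y) y) - 2 * t * (norm (P y))\<^sup>2 + t\<^sup>2 * (l * (norm (P y))\<^sup>2)"
      using assms(4) by (intro add_left_mono mult_left_mono) auto
    finally show ?thesis .
  qed
  show ?thesis
  proof (cases "l = 0")
    case True
    have "Re (cinner (P y) y) \<le> 0" using assms(3) True by simp
    moreover have "0 \<le> Re (cinner (P y) y) - 2 * (norm (P y))\<^sup>2" using *[of 1] True by simp
    ultimately show ?thesis unfolding True by linarith
  next
    case False
    then show ?thesis using *[of "1 / l"] assms(2) by (simp add: field_simps power2_eq_square)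
  qed
qed

text \<open>On the orthogonal complement of finitely many eigenvectors the quadratic form attains its
  supremum \<open>l\<close> over the unit sphere. If \<open>l = 0\<close>, then \<open>P\<close> vanishes there. Otherwise, along a maximising
  sequence \<open>x\<close>, the vectors \<open>P x - l x\<close> tend to \<open>0\<close>, so that a convergent subsequence of \<open>P x\<close> makes \<open>x\<close>
  itself converge along it, to an eigenvector.\<close>

lemma max_eigenvector:
  fixes P :: "'a::complex_hilbert_space \<Rightarrow> 'a"
  assumes inf: "infinite_dimensional TYPE('a)" and cpt: "compact_op P" and pos: "positive_op P"
    and F: "finite F" "orthonormal_set F" "\<And>f. f \<in> F \<Longrightarrow> \<exists>s. P f = s *\<^sub>R f"
  shows "\<exists>e l. norm e = 1 \<and> (\<forall>f\<in>F. cinner e f = 0) \<and> P e = l *\<^sub>R e \<and> 0 \<le> l \<and>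
     (\<forall>y. (\<forall>f\<in>F. cinner y f = 0) \<longrightarrow> Re (cinner (P y) y) \<le> l * (norm y)\<^sup>2)"
proof -
  have P: "bounded_op P" using cpt by (simp add: compact_op_def)
  define M where "M = {x. \<forall>f\<in>F. cinner x f = 0}"
  have PM: "P x \<in> M" if "x \<in> M" for x
  proof -
    have "cinner (P x) f = 0" if f: "f \<in> F" for f
    proof -
      obtain s where "P f = s *\<^sub>R f" using F(3) f by blast
      then show ?thesis using \<open>x \<in> M\<close> f
        by (simp add: positive_op_selfadjoint[OF pos] cinner_scaleR_right M_def)
    qed
    then show ?thesis by (simp add: M_def)
  qed
  obtain x0 where "x0 \<notin> cspan F" using inf F(1) unfolding infinite_dimensional_def by blast
  then obtain e0 where e0: "e0 \<in> M" "norm e0 = 1"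
    using extend_orthonormal_one[OF F(1,2)] unfolding M_def by blast
  define S where "S = {x \<in> M. norm x = 1}"
  define q where "q x = Re (cinner (P x) x)" for x
  define l where "l = Sup (q ` S)"
  obtain K where K: "K > 0" "\<And>x. norm (P x) \<le> K * norm x" using bounded_op_bound[OF P] by blast
  have "q x \<le> K" if "x \<in> S" for x
  proof -
    have "q x \<le> norm (P x) * norm x" unfolding q_def by (rule Re_cinner_le)
    also have "\<dots> \<le> K" using K(2)[of x] that by (simp add: S_def)
    finally show ?thesis .
  qed
  then have bdd: "bdd_above (q ` S)" by (intro bdd_aboveI[of _ K]) auto
  have ne: "q ` S \<noteq> {}" using e0 by (auto simp: S_def)
  have ql: "q x \<le> l" if "x \<in> S" for x unfolding l_def using bdd that by (intro cSup_upper) auto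
  have l0: "0 \<le> l" using ql[of e0] positive_op_Re[OF pos, of e0] e0 by (simp add: S_def q_def)
  have qM: "q y \<le> l * (norm y)\<^sup>2" if "y \<in> M" for y
  proof (cases "y = 0")
    case False
    have "inverse (norm y) *\<^sub>R y \<in> S" using False that by (simp add: S_def M_def cinner_scaleR_left)
    from ql[OF this] have "(inverse (norm y))\<^sup>2 * q y \<le> l"
      using False
      by (simp add: q_def bounded_op_scaleR[OF P] cinner_simps power2_eq_square field_simps)
    then show ?thesis using False by (simp add: field_simps)
  qed (simp add: q_def)
  have key: "(norm (P y))\<^sup>2 \<le> l * q y" if "y \<in> M" for y
    unfolding q_def using qM[OF that] qM[OF PM[OF that]] norm_sq_le_form[OF pos l0] by (simp add: q_def)
  have "\<exists>e\<in>S. P e = l *\<^sub>R e"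
  proof (cases "l = 0")
    case True
    then show ?thesis using key[OF e0(1)] e0 by (auto simp: S_def)
  next
    case False
    then have lpos: "l > 0" using l0 by simp
    have "\<exists>x\<in>S. q x > l - 1 / (real n + 1)" for n
    proof -
      have "l - 1 / (real n + 1) < Sup (q ` S)" unfolding l_def[symmetric] by simp
      from less_cSupD[OF ne this] show ?thesis by auto
    qed
    then obtain x where x: "\<And>n. x n \<in> S" "\<And>n. q (x n) > l - 1 / (real n + 1)" by metis
    have nx: "norm (x n) = 1" for n using x(1)[of n] by (simp add: S_def)
    obtain s y where s: "strict_mono s" "(\<lambda>n. P (x (s n))) \<longlonglongrightarrow> y"
      using compact_op_subseq[OF cpt, of x] nx by auto
    have "(\<lambda>n. (norm (P (x n) - l *\<^sub>R x n))\<^sup>2) \<longlonglongrightarrow> 0"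
    proof (rule tendsto_sandwich[OF always_eventually always_eventually tendsto_const])
      show "\<forall>n. 0 \<le> (norm (P (x n) - l *\<^sub>R x n))\<^sup>2" by simp
      show "\<forall>n. (norm (P (x n) - l *\<^sub>R x n))\<^sup>2 \<le> l * inverse (real (Suc n))"
      proof
        fix n
        have "(norm (P (x n) - l *\<^sub>R x n))\<^sup>2 = (norm (P (x n)))\<^sup>2 + l\<^sup>2 - 2 * l * q (x n)"
          unfolding norm_diff_sq by (simp add: cinner_simps q_def nx)
        also have "\<dots> \<le> l * (l - q (x n))"
          using key[of "x n"] x(1)[of n] by (simp add: S_def power2_eq_square algebra_simps)
        also have "\<dots> \<le> l * inverse (real (Suc n))"
          using x(2)[of n] l0 by (intro mult_left_mono) (auto simp: inverse_eq_divide add.commute)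
        finally show "(norm (P (x n) - l *\<^sub>R x n))\<^sup>2 \<le> l * inverse (real (Suc n))" .
      qed
      show "(\<lambda>n. l * inverse (real (Suc n))) \<longlonglongrightarrow> 0"
        using tendsto_mult_left[OF LIMSEQ_inverse_real_of_nat, of l] by simp
    qed
    then have "(\<lambda>n. sqrt ((norm (P (x n) - l *\<^sub>R x n))\<^sup>2)) \<longlonglongrightarrow> sqrt 0" by (rule tendsto_real_sqrt)
    then have "(\<lambda>n. P (x n) - l *\<^sub>R x n) \<longlonglongrightarrow> 0" by (simp add: tendsto_norm_zero_iff)
    from LIMSEQ_subseq_LIMSEQ[OF this s(1)]
    have "(\<lambda>n. P (x (s n)) - l *\<^sub>R x (s n)) \<longlonglongrightarrow> 0" by (simp add: o_def)
    from tendsto_diff[OF s(2) this] have "(\<lambda>n. l *\<^sub>R x (s n)) \<longlonglongrightarrow> y" by simp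
    from tendsto_scaleR[OF tendsto_const[of "inverse l"] this]
    have lim: "(\<lambda>n. x (s n)) \<longlonglongrightarrow> inverse l *\<^sub>R y" using lpos by simp
    define e where "e = inverse l *\<^sub>R y"
    have lim: "(\<lambda>n. x (s n)) \<longlonglongrightarrow> e" using lim by (simp add: e_def)
    have "(\<lambda>n. norm (x (s n))) \<longlonglongrightarrow> norm e" using lim by (rule tendsto_norm)
    then have "norm e = 1" by (simp add: nx LIMSEQ_const_iff)
    moreover have "cinner e f = 0" if "f \<in> F" for f
    proof -
      have "(\<lambda>n. cinner (x (s n)) f) \<longlonglongrightarrow> cinner e f"
        by (rule bounded_linear.tendsto[OF bounded_linear_cinner_left lim])
      moreover have "cinner (x (s n)) f = 0" for n using x(1)[of "s n"] that by (simp add: S_def M_def)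
      ultimately show ?thesis by (simp add: LIMSEQ_const_iff)
    qed
    moreover have "P e = l *\<^sub>R e"
    proof -
      have "(\<lambda>n. P (x (s n))) \<longlonglongrightarrow> P e"
        using P by (intro bounded_linear.tendsto[OF _ lim]) (simp add: bounded_op_def)
      from LIMSEQ_unique[OF this s(2)] show ?thesis using lpos by (simp add: e_def)
    qed
    ultimately show ?thesis by (auto simp: S_def M_def)
  qed
  then obtain e where "e \<in> S" "P e = l *\<^sub>R e" by blast
  then show ?thesis using l0 qM by (intro exI[of _ e] exI[of _ l]) (auto simp: S_def M_def q_def)
qed

text \<open>Maximising eigenvectors are chosen one after another, each orthogonal to its predecessors. Their
  eigenvalues tend to \<open>0\<close>, because \<open>P\<close> maps orthonormal eigenvectors with eigenvalues at least \<open>L\<close> to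
  vectors at mutual distance at least \<open>L\<close>, which have no convergent subsequence.\<close>

theorem spectral_theorem:
  fixes P :: "'a::complex_hilbert_space \<Rightarrow> 'a"
  assumes inf: "infinite_dimensional TYPE('a)" and cpt: "compact_op P" and pos: "positive_op P"
  obtains e l where "orthonormal_seq e" "antimono l" "\<And>j. 0 \<le> l j" "l \<longlonglongrightarrow> 0"
    "\<And>j. P (e j) = l j *\<^sub>R e j"
    "\<And>n y. (\<And>i. i < n \<Longrightarrow> cinner y (e i) = 0) \<Longrightarrow> Re (cinner (P y) y) \<le> l n * (norm y)\<^sup>2"
proof -
  define good where "good F e l \<longleftrightarrow> norm e = 1 \<and> (\<forall>f\<in>F. cinner e f = 0) \<and> P e = l *\<^sub>R e \<and> 0 \<le> l \<and>
     (\<forall>y. (\<forall>f\<in>F. cinner y f = 0) \<longrightarrow> Re (cinner (P y) y) \<le> l * (norm y)\<^sup>2)" for F e and l :: real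
  define adm where "adm F \<longleftrightarrow> finite F \<and> orthonormal_set F \<and> (\<forall>f\<in>F. \<exists>s. P f = s *\<^sub>R f)" for F
  define inv where "inv n X \<longleftrightarrow> (case X of (F, e, l) \<Rightarrow> (n = 0 \<longrightarrow> F = {}) \<and> adm F \<and> good F e l)"
    for n :: nat and X
  define nxt where "nxt n X Y \<longleftrightarrow> (case (X, Y) of ((F, e, l), (F', _, _)) \<Rightarrow> F' = insert e F)"
    for n :: nat and X Y :: "'a set \<times> 'a \<times> real"
  have step: "\<exists>e l. good F e l" if "adm F" for F
    using max_eigenvector[OF inf cpt pos] that unfolding good_def adm_def by blast
  have "\<exists>f. \<forall>n. inv n (f n) \<and> nxt n (f n) (f (Suc n))"
  proof (rule dependent_nat_choice)
    have "adm {}" by (simp add: adm_def orthonormal_set_def)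
    with step obtain e l where "good {} e l" by blast
    with \<open>adm {}\<close> show "\<exists>X. inv 0 X" by (intro exI[of _ "({}, e, l)"]) (simp add: inv_def)
    fix X n assume X: "inv n X"
    obtain F e l where Xe: "X = (F, e, l)" by (cases X)
    have ad: "adm F" and gd: "good F e l" using X by (auto simp: inv_def Xe)
    have "cinner f e = 0" if "f \<in> F" for f
      using gd that unfolding good_def by (metis cinner_commute complex_cnj_zero)
    then have "adm (insert e F)"
      using ad gd cinner_same[of e] unfolding adm_def good_def orthonormal_set_def by auto
    moreover from step[OF this] obtain e' l' where "good (insert e F) e' l'" by blast
    ultimately show "\<exists>Y. inv (Suc n) Y \<and> nxt n X Y"
      by (intro exI[of _ "(insert e F, e', l')"]) (simp add: inv_def nxt_def Xe)
  qed
  then obtain f where f: "\<And>n. inv n (f n)" "\<And>n. nxt n (f n) (f (Suc n))" by blast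
  define e where "e n = fst (snd (f n))" for n
  define l where "l n = snd (snd (f n))" for n

  have F: "fst (f n) = e ` {..<n}" for n
  proof (induction n)
    case 0
    then show ?case using f(1)[of 0] by (simp add: inv_def case_prod_beta)
  next
    case (Suc n)
    have "fst (f (Suc n)) = insert (e n) (fst (f n))"
      using f(2)[of n] by (simp add: nxt_def case_prod_beta e_def)
    then show ?case using Suc by (simp add: lessThan_Suc)
  qed
  have g: "good (e ` {..<n}) (e n) (l n)" for n
    using f(1)[of n] F[of n] by (simp add: inv_def case_prod_beta e_def l_def)
  have less: "cinner (e j) (e i) = 0" if "i < j" for i j
    using g[of j] that by (auto simp: good_def)
  have on: "orthonormal_seq e"
    unfolding orthonormal_seq_def
  proof (intro allI)
    fix i j
    have "cinner (e i) (e i) = 1" using g[of i] by (simp add: good_def cinner_same)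
    moreover have "cinner (e i) (e j) = 0" if "i \<noteq> j"
      using that less[of i j] less[of j i] cinner_commute[of "e i" "e j"]
      by (cases "i < j") auto
    ultimately show "cinner (e i) (e j) = (if i = j then 1 else 0)" by auto
  qed
  have ev: "P (e j) = l j *\<^sub>R e j" and l0: "0 \<le> l j" for j using g[of j] by (simp_all add: good_def)
  have bd: "Re (cinner (P y) y) \<le> l n * (norm y)\<^sup>2" if "\<And>i. i < n \<Longrightarrow> cinner y (e i) = 0" for n y
    using g[of n] that unfolding good_def by auto
  have am: "antimono l"
  proof (rule decseq_SucI)
    fix n
    have "Re (cinner (P (e (Suc n))) (e (Suc n))) \<le> l n * (norm (e (Suc n)))\<^sup>2"
      by (rule bd) (auto intro: less)
    then show "l (Suc n) \<le> l n"
      by (simp add: ev cinner_simps orthonormal_seqD[OF on] orthonormal_seq_norm[OF on])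
  qed
  obtain L where L: "l \<longlonglongrightarrow> L" "\<And>n. L \<le> l n"
    using decseq_convergent[OF am] l0 by metis
  have "L = 0"
  proof (rule ccontr)
    assume "L \<noteq> 0"
    moreover have "L \<ge> 0" using L(1) l0 by (intro LIMSEQ_le_const) auto
    ultimately have Lpos: "L > 0" by simp
    obtain s y where s: "strict_mono s" "(\<lambda>n. P (e (s n))) \<longlonglongrightarrow> y"
      using compact_op_subseq[OF cpt, of e] orthonormal_seq_norm[OF on] by auto
    from s(2) have "Cauchy (\<lambda>n. P (e (s n)))" by (rule LIMSEQ_imp_Cauchy)
    then obtain N where N: "\<And>m n. m \<ge> N \<Longrightarrow> n \<ge> N \<Longrightarrow> dist (P (e (s m))) (P (e (s n))) < L"
      unfolding Cauchy_def using Lpos by meson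
    define i j where "i = s N" and "j = s (Suc N)"
    have ij: "i \<noteq> j" using s(1) unfolding i_def j_def by (simp add: strict_mono_eq)
    have "(norm (P (e i) - P (e j)))\<^sup>2 = (l i)\<^sup>2 + (l j)\<^sup>2"
      unfolding norm_diff_sq ev
      using ij by (simp add: cinner_simps orthonormal_seqD[OF on] orthonormal_seq_norm[OF on])
    moreover have "L\<^sup>2 \<le> (l i)\<^sup>2" using L(2)[of i] Lpos by (intro power_mono) auto
    moreover have "0 \<le> (l j)\<^sup>2" by simp
    ultimately have "L\<^sup>2 \<le> (norm (P (e i) - P (e j)))\<^sup>2" by linarith
    then have "L \<le> norm (P (e i) - P (e j))" by (rule power2_le_imp_le) simp
    then show False using N[of N "Suc N"] by (simp add: dist_norm i_def j_def)
  qed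
  then show thesis using that[OF on am l0 _ ev bd] L(1) by blast
qed

text \<open>An eigenvector \<open>x\<close> for \<open>s > 0\<close> has coefficient \<open>0\<close> at every \<open>e j\<close> with \<open>l j \<noteq> s\<close>. What remains of \<open>x\<close>
  after subtracting its components along the other \<open>e j\<close> is an eigenvector for \<open>s\<close> in the kernel of \<open>P\<close>,
  hence \<open>0\<close>.\<close>

lemma eigenvalue_sequenceI:
  fixes P :: "'a::complex_hilbert_space \<Rightarrow> 'a"
  assumes P: "bounded_op P" and sa: "\<And>x y. cinner (P x) y = cinner x (P y)"
    and e: "orthonormal_seq e" and ev: "\<And>j. P (e j) = l j *\<^sub>R e j"
    and ker: "\<And>y. (\<And>j. cinner y (e j) = 0) \<Longrightarrow> P y = 0"
    and l: "antimono l" "\<And>j. 0 \<le> l j" "l \<longlonglongrightarrow> 0"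
  shows "eigenvalue_sequence P l"
proof -
  have "card {j. l j = s} = cdim {x. P x = s *\<^sub>R x}" if s: "s > 0" for s
  proof -
    define J where "J = {j. l j = s}"
    have "eventually (\<lambda>j. l j < s) sequentially" using l(3) s by (rule order_tendstoD)
    then obtain N where N: "\<And>j. j \<ge> N \<Longrightarrow> l j < s" by (auto simp: eventually_sequentially)
    have fin: "finite J"
      by (rule finite_subset[of _ "{..<N}"]) (use N in \<open>force simp: J_def not_le[symmetric]\<close>, simp)
    have oJ: "orthonormal_set (e ` J)" by (rule orthonormal_seq_image[OF e])
    have "{x. P x = s *\<^sub>R x} = cspan (e ` J)"
    proof (intro set_eqI iffI)
      fix x assume "x \<in> cspan (e ` J)"
      then show "x \<in> {x. P x = s *\<^sub>R x}"
      proof (induction rule: complex_vector.span_induct_alt)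
        case base then show ?case by (simp add: bounded_op_zero[OF P])
      next
        case (step c x y)
        then obtain j where "x = e j" "l j = s" by (auto simp: J_def)
        then have "P x = s *\<^sub>R x" by (simp add: ev)
        then show ?case using step
          by (simp add: bounded_op_add[OF P] bounded_op_cscale[OF P] cscale_add_right
              cscale_cscale mult.commute flip: cscale_of_real)
      qed
    next
      fix x assume "x \<in> {x. P x = s *\<^sub>R x}"
      then have x: "P x = s *\<^sub>R x" by simp
      define z where "z = orth_residual (e ` J) x"
      have xj: "cinner x (e j) = 0" if "j \<notin> J" for j
      proof -
        have "complex_of_real s * cinner x (e j) = complex_of_real (l j) * cinner x (e j)"
          using sa[of x "e j"] by (simp add: x ev cinner_simps)
        then show ?thesis using that by (simp add: J_def)
      qed
      have pJ: "(\<Sum>f\<in>e ` J. cscale (cinner x f) f) \<in> cspan (e ` J)"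
        by (intro complex_vector.span_sum complex_vector.span_scale complex_vector.span_base)
      have "cinner z (e j) = 0" for j
      proof (cases "j \<in> J")
        case True
        then show ?thesis using fin oJ by (simp add: z_def cinner_orth_residual)
      next
        case False
        have "cinner (\<Sum>f\<in>e ` J. cscale (cinner x f) f) (e j) = 0"
          unfolding cinner_sum_left cinner_scale_left using False
          by (intro sum.neutral) (auto simp: orthonormal_seqD[OF e])
        then show ?thesis using xj[OF False] by (simp add: z_def orth_residual_def cinner_diff_left)
      qed
      then have "P z = 0" by (rule ker)
      moreover have "P z = s *\<^sub>R z"
      proof -
        have "P (\<Sum>f\<in>e ` J. cscale (cinner x f) f) = s *\<^sub>R (\<Sum>f\<in>e ` J. cscale (cinner x f) f)"
          unfolding bounded_op_sum[OF P] scaleR_sum_right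
          by (intro sum.cong) (auto simp: bounded_op_cscale[OF P] ev J_def cscale_cscale mult.commute
              simp flip: cscale_of_real)
        then show ?thesis by (simp add: z_def orth_residual_def bounded_op_diff[OF P] x scaleR_diff_right)
      qed
      ultimately have "z = 0" using s by simp
      then have "x = (\<Sum>f\<in>e ` J. cscale (cinner x f) f)" by (simp add: z_def orth_residual_def)
      then show "x \<in> cspan (e ` J)" using pJ by simp
    qed
    moreover have "complex_vector.independent (e ` J)"
    proof (rule complex_vector.independent_if_scalars_zero)
      show "finite (e ` J)" using fin by simp
      fix f x assume *: "(\<Sum>x\<in>e ` J. cscale (f x) x) = 0" and x: "x \<in> e ` J"
      have "0 = cinner (\<Sum>y\<in>e ` J. cscale (f y) y) x" by (simp add: *)
      also have "\<dots> = (\<Sum>y\<in>e ` J. if y = x then f y else 0)"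
        unfolding cinner_sum_left cinner_scale_left using oJ x
        by (intro sum.cong) (auto simp: orthonormal_set_def)
      also have "\<dots> = f x" using fin x by simp
      finally show "f x = 0" by simp
    qed
    ultimately have "cdim {x. P x = s *\<^sub>R x} = card (e ` J)"
      using complex_vector.dim_span_eq_card_independent[of "e ` J"] by argo
    also have "\<dots> = card J"
      by (intro card_image inj_on_subset[OF orthonormal_seq_inj[OF e]]) simp
    finally show ?thesis by (simp add: J_def)
  qed
  then show ?thesis using l by (simp add: eigenvalue_sequence_def)
qed

lemma eigval_eqI: "eigenvalue_sequence T l \<Longrightarrow> eigval T = l"
  unfolding eigval_def using eigenvalue_sequence_unique by (intro the_equality) auto

text \<open>On the orthogonal complement of all vectors \<open>e j\<close> the form is bounded by \<open>l n\<close> for every \<open>n\<close>, so that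
  \<open>P\<close> vanishes there. Hence no positive eigenvalue is missing from \<open>l\<close>.\<close>

theorem eigval_spectral:
  fixes P :: "'a::complex_hilbert_space \<Rightarrow> 'a"
  assumes inf: "infinite_dimensional TYPE('a)" and cpt: "compact_op P" and pos: "positive_op P"
  obtains e where "orthonormal_seq e" "\<And>j. 0 \<le> eigval P j" "eigval P \<longlonglongrightarrow> 0"
    "\<And>j. P (e j) = eigval P j *\<^sub>R e j"
    "\<And>n y. (\<And>i. i < n \<Longrightarrow> cinner y (e i) = 0) \<Longrightarrow> Re (cinner (P y) y) \<le> eigval P n * (norm y)\<^sup>2"
proof -
  obtain e l where e: "orthonormal_seq e" and l: "antimono l" "\<And>j. 0 \<le> l j" "l \<longlonglongrightarrow> 0"
    and ev: "\<And>j. P (e j) = l j *\<^sub>R e j"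
    and bd: "\<And>n y. (\<And>i. i < n \<Longrightarrow> cinner y (e i) = 0) \<Longrightarrow> Re (cinner (P y) y) \<le> l n * (norm y)\<^sup>2"
    using spectral_theorem[OF assms] by blast
  have P: "bounded_op P" using cpt by (simp add: compact_op_def)
  have ker: "P y = 0" if y: "\<And>j. cinner y (e j) = 0" for y
  proof -
    have small: "Re (cinner (P z) z) \<le> 0 * (norm z)\<^sup>2" if z: "\<And>j. cinner z (e j) = 0" for z
    proof (rule LIMSEQ_le_const)
      show "(\<lambda>n. l n * (norm z)\<^sup>2) \<longlonglongrightarrow> 0 * (norm z)\<^sup>2" by (intro tendsto_intros l)
      show "\<exists>N. \<forall>n\<ge>N. Re (cinner (P z) z) \<le> l n * (norm z)\<^sup>2" using bd z by blast
    qed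
    have "cinner (P y) (e j) = 0" for j
      by (simp add: positive_op_selfadjoint[OF pos] ev cinner_scaleR_right y)
    from norm_sq_le_form[OF pos order_refl small[OF y] small[OF this]] show ?thesis by simp
  qed
  have "eigenvalue_sequence P l"
    by (rule eigenvalue_sequenceI[OF P positive_op_selfadjoint[OF pos] e ev ker l])
  then have "eigval P = l" by (rule eigval_eqI)
  then show thesis using that[of e] e l ev bd by blast
qed

section \<open>The ideal and its partial traces\<close>

lemma compact_positive_adjoint_comp:
  assumes "compact_op T"
  shows "compact_op (adjoint_op T \<circ> T)" "positive_op (adjoint_op T \<circ> T)"
proof -
  have T: "bounded_op T" using assms by (simp add: compact_op_def)
  show "compact_op (adjoint_op T \<circ> T)"
    by (rule compact_op_compose_left[OF bounded_op_adjoint[OF T] assms])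
  show "positive_op (adjoint_op T \<circ> T)"
    unfolding positive_op_def using bounded_op_compose[OF bounded_op_adjoint[OF T] T]
    by (auto simp: adjoint_op_swap[OF T] cinner_same complex_nonneg_Reals_iff)
qed

text \<open>Since \<open>\<parallel>T y\<parallel>\<^sup>2 = \<langle>T\<^sup>* T y, y\<rangle>\<close>, cutting off \<open>T\<close> at the first \<open>n\<close> eigenvectors of \<open>T\<^sup>* T\<close>
  leaves an operator of norm at most \<open>\<mu>\<^sub>n(T)\<close>.\<close>

lemma ideal_truncation:
  fixes T :: "'a::complex_hilbert_space \<Rightarrow> 'a"
  assumes inf: "infinite_dimensional TYPE('a)" and T: "T \<in> weak_lorentz_ideal g"
    and g: "\<And>n. 0 < g (real n)"
  obtains u C where "orthonormal_seq u" "0 < C"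
    "\<forall>\<^sub>F n in sequentially. \<forall>y. (\<forall>i<n. cinner y (u i) = 0) \<longrightarrow> norm (T y) \<le> C * g (real n) * norm y"
proof -
  have cpt: "compact_op T" and O: "singval T \<in> O(\<lambda>j. g (real j))"
    using T by (auto simp: weak_lorentz_ideal_def)
  have b: "bounded_op T" using cpt by (simp add: compact_op_def)
  obtain u where u: "orthonormal_seq u" and l0: "\<And>j. 0 \<le> eigval (adjoint_op T \<circ> T) j"
    and bd: "\<And>n y. (\<And>i. i < n \<Longrightarrow> cinner y (u i) = 0) \<Longrightarrow>
      Re (cinner ((adjoint_op T \<circ> T) y) y) \<le> eigval (adjoint_op T \<circ> T) n * (norm y)\<^sup>2"
    using eigval_spectral[OF inf compact_positive_adjoint_comp[OF cpt]] by metis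
  obtain C where C: "C > 0" "\<forall>\<^sub>F n in sequentially. norm (singval T n) \<le> C * norm (g (real n))"
    using landau_o.bigE[OF O] by blast
  from C(2) have "\<forall>\<^sub>F n in sequentially. \<forall>y. (\<forall>i<n. cinner y (u i) = 0) \<longrightarrow>
      norm (T y) \<le> C * g (real n) * norm y"
  proof (rule eventually_mono, intro allI impI)
    fix n y assume n: "norm (singval T n) \<le> C * norm (g (real n))" and y: "\<forall>i<n. cinner y (u i) = 0"
    have "(norm (T y))\<^sup>2 = Re (cinner ((adjoint_op T \<circ> T) y) y)"
      by (simp add: adjoint_op_swap[OF b] Re_cinner_same)
    also have "\<dots> \<le> (singval T n)\<^sup>2 * (norm y)\<^sup>2"
      using bd[of n y] y l0[of n] by (simp add: singval_def)
    finally have "(norm (T y))\<^sup>2 \<le> (singval T n * norm y)\<^sup>2" by (simp add: power_mult_distrib)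
    then have "norm (T y) \<le> \<bar>singval T n * norm y\<bar>"
      by (metis abs_le_square_iff abs_norm_cancel)
    also have "\<dots> \<le> C * g (real n) * norm y"
      using n g[of n] by (simp add: abs_mult mult_right_mono)
    finally show "norm (T y) \<le> C * g (real n) * norm y" .
  qed
  then show thesis using that u C(1) by blast
qed

definition trace_on :: "'a::complex_hilbert_space set \<Rightarrow> ('a \<Rightarrow> 'a) \<Rightarrow> complex" where
  "trace_on E X = (\<Sum>e\<in>E. cinner (X e) e)"

text \<open>If the span of \<open>E\<close> contains the vectors \<open>u i\<close> and \<open>T (u i)\<close> for \<open>i < n\<close>, the truncation of \<open>T\<close>
  to \<open>u 0, \<dots>, u (n - 1)\<close> acts inside that span, so that its commutators have trace zero there as
  in finite dimension. Only the remainder of \<open>T\<close>, of norm at most \<open>b\<close>, contributes.\<close>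

lemma trace_on_commutator_le:
  assumes E: "finite E" "orthonormal_set E"
    and A: "bounded_op A" "\<And>x. norm (A x) \<le> K * norm x" "0 \<le> K"
    and T: "bounded_op T" and u: "orthonormal_seq u"
    and uE: "\<And>i. i < n \<Longrightarrow> u i \<in> cspan E" and wE: "\<And>i. i < n \<Longrightarrow> T (u i) \<in> cspan E"
    and b: "\<And>y. (\<And>i. i < n \<Longrightarrow> cinner y (u i) = 0) \<Longrightarrow> norm (T y) \<le> b * norm y" "0 \<le> b"
  shows "cmod (trace_on E (\<lambda>x. A (T x) - T (A x))) \<le> real (card E) * (2 * K * b)"
proof -
  define R where "R x = T (orth_residual (u ` {..<n}) x)" for x
  define F where "F x = (\<Sum>i<n. cscale (cinner x (u i)) (T (u i)))" for x
  have on: "finite (u ` {..<n})" "orthonormal_set (u ` {..<n})"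
    using orthonormal_seq_image[OF u] by auto
  have TFR: "T x = F x + R x" for x
  proof -
    have "(\<Sum>e\<in>u ` {..<n}. cscale (cinner x e) e) = (\<Sum>i<n. cscale (cinner x (u i)) (u i))"
      by (rule sum.reindex[unfolded o_def]) (rule inj_on_subset[OF orthonormal_seq_inj[OF u]], simp)
    then have "R x = T x - F x"
      by (simp add: R_def F_def orth_residual_def bounded_op_diff[OF T] bounded_op_sum[OF T]
          bounded_op_cscale[OF T])
    then show ?thesis by simp
  qed
  have R: "norm (R x) \<le> b * norm x" for x
  proof -
    have "norm (R x) \<le> b * norm (orth_residual (u ` {..<n}) x)"
      unfolding R_def by (rule b) (simp add: cinner_orth_residual[OF on])
    also have "\<dots> \<le> b * norm x" by (intro mult_left_mono norm_orth_residual_le on b)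
    finally show ?thesis .
  qed
  have AF: "(\<Sum>e\<in>E. cinner (A (F e)) e) = (\<Sum>i<n. cinner (A (T (u i))) (u i))"
  proof -
    have "(\<Sum>e\<in>E. cinner (A (F e)) e) = (\<Sum>i<n. \<Sum>e\<in>E. cinner e (u i) * cinner (A (T (u i))) e)"
      unfolding F_def bounded_op_sum[OF A(1)] bounded_op_cscale[OF A(1)] cinner_sum_left cinner_scale_left
      by (rule sum.swap)
    also have "\<dots> = (\<Sum>i<n. cinner (A (T (u i))) (u i))"
    proof (rule sum.cong[OF refl])
      fix i assume "i \<in> {..<n}"
      then have ui: "u i = (\<Sum>e\<in>E. cscale (cinner (u i) e) e)"
        using orth_expansion_in_span[OF E uE] by simp
      have "cinner (A (T (u i))) (u i) = cinner (A (T (u i))) (\<Sum>e\<in>E. cscale (cinner (u i) e) e)"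
        using ui by (rule arg_cong)
      also have "\<dots> = (\<Sum>e\<in>E. cinner e (u i) * cinner (A (T (u i))) e)"
        unfolding cinner_sum_right cinner_scale_right by (simp flip: cinner_commute)
      finally show "(\<Sum>e\<in>E. cinner e (u i) * cinner (A (T (u i))) e) = cinner (A (T (u i))) (u i)" ..
    qed
    finally show ?thesis .
  qed
  have FA: "(\<Sum>e\<in>E. cinner (F (A e)) e) = (\<Sum>i<n. cinner (A (T (u i))) (u i))"
  proof -
    have "(\<Sum>e\<in>E. cinner (F (A e)) e) = (\<Sum>i<n. \<Sum>e\<in>E. cinner (A e) (u i) * cinner (T (u i)) e)"
      unfolding F_def cinner_sum_left cinner_scale_left by (rule sum.swap)
    also have "\<dots> = (\<Sum>i<n. cinner (A (T (u i))) (u i))"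
    proof (rule sum.cong[OF refl])
      fix i assume "i \<in> {..<n}"
      then have wi: "T (u i) = (\<Sum>e\<in>E. cscale (cinner (T (u i)) e) e)"
        using orth_expansion_in_span[OF E wE] by simp
      have "cinner (A (T (u i))) (u i) = cinner (A (\<Sum>e\<in>E. cscale (cinner (T (u i)) e) e)) (u i)"
        using wi by (rule arg_cong)
      also have "\<dots> = (\<Sum>e\<in>E. cinner (A e) (u i) * cinner (T (u i)) e)"
        unfolding bounded_op_sum[OF A(1)] bounded_op_cscale[OF A(1)] cinner_sum_left cinner_scale_left
        by (simp add: mult.commute)
      finally show "(\<Sum>e\<in>E. cinner (A e) (u i) * cinner (T (u i)) e) = cinner (A (T (u i))) (u i)" ..
    qed
    finally show ?thesis .
  qed
  have "trace_on E (\<lambda>x. A (T x) - T (A x)) = (\<Sum>e\<in>E. cinner (A (R e) - R (A e)) e)"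
  proof -
    have "cinner (A (T e) - T (A e)) e
        = cinner (A (F e)) e - cinner (F (A e)) e + cinner (A (R e) - R (A e)) e" for e
      unfolding TFR by (simp add: bounded_op_add[OF A(1)] cinner_simps)
    then show ?thesis unfolding trace_on_def by (simp add: sum.distrib sum_subtractf AF FA)
  qed
  also have "cmod \<dots> \<le> (\<Sum>e\<in>E. 2 * K * b)"
  proof (intro order_trans[OF norm_sum] sum_mono)
    fix e assume "e \<in> E"
    then have ne: "norm e = 1" by (rule orthonormal_set_norm[OF E(2)])
    have "norm (A (R e)) \<le> K * norm (R e)" by (rule A)
    also have "\<dots> \<le> K * b" using R[of e] ne A(3) by (intro mult_left_mono) auto
    finally have 1: "norm (A (R e)) \<le> K * b" .
    have "norm (R (A e)) \<le> b * norm (A e)" by (rule R)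
    also have "\<dots> \<le> b * K" using A(2)[of e] ne b(2) by (intro mult_left_mono) auto
    finally have 2: "norm (R (A e)) \<le> K * b" by (simp add: mult.commute)
    have "cmod (cinner (A (R e) - R (A e)) e) \<le> norm (A (R e) - R (A e)) * norm e"
      by (rule cauchy_schwarz)
    also have "\<dots> \<le> 2 * K * b"
      using norm_triangle_ineq4[of "A (R e)" "R (A e)"] 1 2 ne by simp
    finally show "cmod (cinner (A (R e) - R (A e)) e) \<le> 2 * K * b" .
  qed
  finally show ?thesis by simp
qed

subsection \<open>The commutator space\<close>

text \<open>Traces vanish on the span of the commutators. It is taken in the space of all functions on
  \<open>\<H>\<close>, where linear functionals can be extended without checking that the ideal is closed under
  addition.\<close>

definition fscale :: "complex \<Rightarrow> ('b \<Rightarrow> 'a::complex_hilbert_space) \<Rightarrow> 'b \<Rightarrow> 'a" where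
  "fscale c X = (\<lambda>x. cscale c (X x))"

global_interpretation fun_space: vector_space fscale
  by standard (simp_all add: fscale_def fun_eq_iff cscale_add_right cscale_add_left cscale_cscale)

global_interpretation fun_functional: vector_space_pair fscale "(*) :: complex \<Rightarrow> complex \<Rightarrow> complex"
  by standard (simp_all add: algebra_simps)

definition com_space :: "(real \<Rightarrow> real) \<Rightarrow> ('a::complex_hilbert_space \<Rightarrow> 'a) set" where
  "com_space g = fun_space.span
     {\<lambda>x. A (T x) - T (A x) | A T. bounded_op A \<and> T \<in> weak_lorentz_ideal g}"

text \<open>The obstruction to being a sum of commutators: the trace of \<open>X\<close> on every subspace of dimension \<open>d\<close>
  that contains suitable \<open>O(n)\<close> vectors \<open>F\<close> is \<open>O(d g(n))\<close>. Unlike a bound on the trace over one fixed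
  subspace, this is stable under sums, as the required sets \<open>F\<close> can be united.\<close>

definition small_traces :: "(real \<Rightarrow> real) \<Rightarrow> ('a::complex_hilbert_space \<Rightarrow> 'a) \<Rightarrow> bool" where
  "small_traces g X \<longleftrightarrow> (\<exists>C\<ge>0. \<forall>\<^sub>F n in sequentially. \<exists>F. finite F \<and> real (card F) \<le> C * real n \<and>
     (\<forall>E. finite E \<longrightarrow> orthonormal_set E \<longrightarrow> F \<subseteq> cspan E \<longrightarrow>
       cmod (trace_on E X) \<le> C * real (card E) * g (real n)))"

lemma small_traces_commutator:
  fixes A T :: "'a::complex_hilbert_space \<Rightarrow> 'a"
  assumes inf: "infinite_dimensional TYPE('a)" and g: "\<And>n. 0 < g (real n)"
    and A: "bounded_op A" and T: "T \<in> weak_lorentz_ideal g"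
  shows "small_traces g (\<lambda>x. A (T x) - T (A x))"
proof -
  obtain K where K: "K > 0" "\<And>x. norm (A x) \<le> K * norm x" using bounded_op_bound[OF A] by blast
  obtain u C where u: "orthonormal_seq u" and C: "0 < C"
    and ev: "\<forall>\<^sub>F n in sequentially. \<forall>y. (\<forall>i<n. cinner y (u i) = 0) \<longrightarrow>
      norm (T y) \<le> C * g (real n) * norm y"
    using ideal_truncation[OF inf T g] by blast
  have b: "bounded_op T" using T by (simp add: weak_lorentz_ideal_def compact_op_def)
  define D where "D = max 2 (2 * K * C)"
  from ev have "\<forall>\<^sub>F n in sequentially. \<exists>F. finite F \<and> real (card F) \<le> D * real n \<and>
     (\<forall>E. finite E \<longrightarrow> orthonormal_set E \<longrightarrow> F \<subseteq> cspan E \<longrightarrow>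
       cmod (trace_on E (\<lambda>x. A (T x) - T (A x))) \<le> D * real (card E) * g (real n))"
  proof (rule eventually_mono)
    fix n assume n: "\<forall>y. (\<forall>i<n. cinner y (u i) = 0) \<longrightarrow> norm (T y) \<le> C * g (real n) * norm y"
    define F where "F = u ` {..<n} \<union> (\<lambda>i. T (u i)) ` {..<n}"
    have "card F \<le> card (u ` {..<n}) + card ((\<lambda>i. T (u i)) ` {..<n})"
      unfolding F_def by (rule card_Un_le)
    also have "\<dots> \<le> n + n" by (intro add_mono order_trans[OF card_image_le]) auto
    finally have "real (card F) \<le> 2 * real n" by simp
    also have "\<dots> \<le> D * real n" by (intro mult_right_mono) (auto simp: D_def)
    finally have card: "real (card F) \<le> D * real n" .
    have "cmod (trace_on E (\<lambda>x. A (T x) - T (A x))) \<le> D * real (card E) * g (real n)"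
      if E: "finite E" "orthonormal_set E" "F \<subseteq> cspan E" for E
    proof -
      have "cmod (trace_on E (\<lambda>x. A (T x) - T (A x))) \<le> real (card E) * (2 * K * (C * g (real n)))"
        using E(3) n K C less_imp_le[OF g[of n]]
        by (intro trace_on_commutator_le[OF E(1,2) A K(2) _ b u, where n = n]) (auto simp: F_def)
      also have "\<dots> = (2 * K * C) * (real (card E) * g (real n))" by simp
      also have "\<dots> \<le> D * (real (card E) * g (real n))"
        using less_imp_le[OF g[of n]] by (intro mult_right_mono) (auto simp: D_def)
      finally show ?thesis by (simp add: mult.assoc)
    qed
    then show "\<exists>F. finite F \<and> real (card F) \<le> D * real n \<and>
     (\<forall>E. finite E \<longrightarrow> orthonormal_set E \<longrightarrow> F \<subseteq> cspan E \<longrightarrow>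
       cmod (trace_on E (\<lambda>x. A (T x) - T (A x))) \<le> D * real (card E) * g (real n))"
      using card by (intro exI[of _ F]) (auto simp: F_def)
  qed
  moreover have "D \<ge> 0" by (simp add: D_def)
  ultimately show ?thesis unfolding small_traces_def by blast
qed

lemma trace_on_lincomb: "trace_on E (fscale c X + Y) = c * trace_on E X + trace_on E Y"
  by (simp add: trace_on_def fscale_def cinner_simps sum.distrib sum_distrib_left)

lemma small_traces_lincomb:
  assumes g: "\<And>n. 0 < g (real n)" and X: "small_traces g X" and Y: "small_traces g Y"
  shows "small_traces g (fscale c X + Y)"
proof -
  obtain C where C: "C \<ge> 0" "\<forall>\<^sub>F n in sequentially. \<exists>F. finite F \<and> real (card F) \<le> C * real n \<and>
     (\<forall>E. finite E \<longrightarrow> orthonormal_set E \<longrightarrow> F \<subseteq> cspan E \<longrightarrow>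
       cmod (trace_on E X) \<le> C * real (card E) * g (real n))"
    using X unfolding small_traces_def by blast
  obtain D where D: "D \<ge> 0" "\<forall>\<^sub>F n in sequentially. \<exists>F. finite F \<and> real (card F) \<le> D * real n \<and>
     (\<forall>E. finite E \<longrightarrow> orthonormal_set E \<longrightarrow> F \<subseteq> cspan E \<longrightarrow>
       cmod (trace_on E Y) \<le> D * real (card E) * g (real n))"
    using Y unfolding small_traces_def by blast
  define M where "M = (1 + cmod c) * C + D"
  have M: "C + D \<le> M" "cmod c * C + D \<le> M" "0 \<le> M" using C(1) D(1) by (auto simp: M_def algebra_simps)
  from C(2) D(2) have "\<forall>\<^sub>F n in sequentially. \<exists>F. finite F \<and> real (card F) \<le> M * real n \<and>
     (\<forall>E. finite E \<longrightarrow> orthonormal_set E \<longrightarrow> F \<subseteq> cspan E \<longrightarrow>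
       cmod (trace_on E (fscale c X + Y)) \<le> M * real (card E) * g (real n))"
  proof eventually_elim
    fix n
    assume "\<exists>F. finite F \<and> real (card F) \<le> C * real n \<and>
     (\<forall>E. finite E \<longrightarrow> orthonormal_set E \<longrightarrow> F \<subseteq> cspan E \<longrightarrow>
       cmod (trace_on E X) \<le> C * real (card E) * g (real n))"
    then obtain F where F: "finite F" "real (card F) \<le> C * real n"
      "\<And>E. finite E \<Longrightarrow> orthonormal_set E \<Longrightarrow> F \<subseteq> cspan E \<Longrightarrow>
       cmod (trace_on E X) \<le> C * real (card E) * g (real n)" by blast
    assume "\<exists>F. finite F \<and> real (card F) \<le> D * real n \<and>
     (\<forall>E. finite E \<longrightarrow> orthonormal_set E \<longrightarrow> F \<subseteq> cspan E \<longrightarrow>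
       cmod (trace_on E Y) \<le> D * real (card E) * g (real n))"
    then obtain G where G: "finite G" "real (card G) \<le> D * real n"
      "\<And>E. finite E \<Longrightarrow> orthonormal_set E \<Longrightarrow> G \<subseteq> cspan E \<Longrightarrow>
       cmod (trace_on E Y) \<le> D * real (card E) * g (real n)" by blast
    have "real (card (F \<union> G)) \<le> real (card F) + real (card G)"
      using card_Un_le[of F G] by linarith
    also have "\<dots> \<le> (C + D) * real n" using F(2) G(2) by (simp add: algebra_simps)
    also have "\<dots> \<le> M * real n" using M(1) by (intro mult_right_mono) auto
    finally have "real (card (F \<union> G)) \<le> M * real n" .
    moreover have "cmod (trace_on E (fscale c X + Y)) \<le> M * real (card E) * g (real n)"
      if E: "finite E" "orthonormal_set E" "F \<union> G \<subseteq> cspan E" for E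
    proof -
      have "cmod (trace_on E (fscale c X + Y)) \<le> cmod c * cmod (trace_on E X) + cmod (trace_on E Y)"
        unfolding trace_on_lincomb norm_mult[symmetric] by (rule norm_triangle_ineq)
      also have "\<dots> \<le> cmod c * (C * real (card E) * g (real n)) + D * real (card E) * g (real n)"
        using F(3)[OF E(1,2)] G(3)[OF E(1,2)] E(3) by (intro add_mono mult_left_mono) auto
      also have "\<dots> = (cmod c * C + D) * (real (card E) * g (real n))" by (simp add: algebra_simps)
      also have "\<dots> \<le> M * (real (card E) * g (real n))"
        using M(2) less_imp_le[OF g[of n]] by (intro mult_right_mono) auto
      finally show ?thesis by (simp add: mult.assoc)
    qed
    ultimately show "\<exists>F. finite F \<and> real (card F) \<le> M * real n \<and>
     (\<forall>E. finite E \<longrightarrow> orthonormal_set E \<longrightarrow> F \<subseteq> cspan E \<longrightarrow>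
       cmod (trace_on E (fscale c X + Y)) \<le> M * real (card E) * g (real n))"
      using F(1) G(1) by (intro exI[of _ "F \<union> G"]) auto
  qed
  then show ?thesis using M(3) unfolding small_traces_def by blast
qed

lemma com_space_small_traces:
  fixes X :: "'a::complex_hilbert_space \<Rightarrow> 'a"
  assumes inf: "infinite_dimensional TYPE('a)" and g: "\<And>n. 0 < g (real n)" and X: "X \<in> com_space g"
  shows "small_traces g X"
  using X unfolding com_space_def
proof (induction rule: fun_space.span_induct_alt)
  case base
  have "\<forall>\<^sub>F n in sequentially. \<exists>F :: 'a set. finite F \<and> real (card F) \<le> 0 * real n \<and>
     (\<forall>E. finite E \<longrightarrow> orthonormal_set E \<longrightarrow> F \<subseteq> cspan E \<longrightarrow>
       cmod (trace_on E (0 :: 'a \<Rightarrow> 'a)) \<le> 0 * real (card E) * g (real n))"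
    by (intro always_eventually allI exI[of _ "{}"]) (simp add: trace_on_def)
  then show ?case unfolding small_traces_def by blast
next
  case (step c X Y)
  then show ?case
    using small_traces_commutator[where g = g, OF inf g] by (intro small_traces_lincomb g) auto
qed

text \<open>For an operator with eigenvectors \<open>e\<close> whose form is \<open>O(g(n))\<close> beyond the \<open>n\<close>-th of them,
  the obstruction bounds the partial sums of the eigenvalues: a subspace containing
  \<open>e 0, \<dots>, e (n - 1)\<close> and the required vectors adds only \<open>O(n)\<close> terms of size \<open>O(g(n))\<close>.\<close>

lemma small_traces_eigenvalue_sums:
  assumes g: "\<And>n. 0 < g (real n)" and S: "small_traces g S"
    and e: "orthonormal_seq e" and ev: "\<And>j. S (e j) = cscale (s j) (e j)"
    and bd: "\<forall>\<^sub>F n in sequentially. \<forall>f. norm f = 1 \<longrightarrow> (\<forall>i<n. cinner f (e i) = 0) \<longrightarrow>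
      cmod (cinner (S f) f) \<le> B * g (real n)"
  shows "\<exists>D\<ge>0. \<forall>\<^sub>F n in sequentially. cmod (\<Sum>j<n. s j) \<le> D * (real n * g (real n))"
proof -
  obtain C where C: "C \<ge> 0" "\<forall>\<^sub>F n in sequentially. \<exists>F. finite F \<and> real (card F) \<le> C * real n \<and>
     (\<forall>E. finite E \<longrightarrow> orthonormal_set E \<longrightarrow> F \<subseteq> cspan E \<longrightarrow>
       cmod (trace_on E S) \<le> C * real (card E) * g (real n))"
    using S unfolding small_traces_def by blast
  define D where "D = (C + \<bar>B\<bar>) * (1 + C)"
  have "\<forall>\<^sub>F n in sequentially. cmod (\<Sum>j<n. s j) \<le> D * (real n * g (real n))"
    using C(2) bd
  proof eventually_elim
    fix n
    assume "\<exists>F. finite F \<and> real (card F) \<le> C * real n \<and>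
     (\<forall>E. finite E \<longrightarrow> orthonormal_set E \<longrightarrow> F \<subseteq> cspan E \<longrightarrow>
       cmod (trace_on E S) \<le> C * real (card E) * g (real n))"
    then obtain F where F: "finite F" "real (card F) \<le> C * real n"
      "\<And>E. finite E \<Longrightarrow> orthonormal_set E \<Longrightarrow> F \<subseteq> cspan E \<Longrightarrow>
       cmod (trace_on E S) \<le> C * real (card E) * g (real n)" by blast
    assume bn: "\<forall>f. norm f = 1 \<longrightarrow> (\<forall>i<n. cinner f (e i) = 0) \<longrightarrow>
      cmod (cinner (S f) f) \<le> B * g (real n)"
    define E0 where "E0 = e ` {..<n}"
    have inj: "inj_on e {..<n}" by (rule inj_on_subset[OF orthonormal_seq_inj[OF e]]) simp
    have E0: "finite E0" "orthonormal_set E0" "card E0 = n"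
      using orthonormal_seq_image[OF e] card_image[OF inj] by (auto simp: E0_def)
    obtain E where E: "E0 \<subseteq> E" "finite E" "orthonormal_set E" "F \<subseteq> cspan E" "card E \<le> n + card F"
      using extend_orthonormal[OF E0(1,2) F(1)] E0(3) by auto
    have cE: "real (card E) \<le> (1 + C) * real n"
      using E(5) F(2) by (simp add: algebra_simps)
    have "trace_on E0 S = (\<Sum>j<n. s j)"
      unfolding trace_on_def E0_def sum.reindex[OF inj]
      by (simp add: ev cinner_scale_left orthonormal_seqD[OF e])
    then have "(\<Sum>j<n. s j) = trace_on E S - (\<Sum>f\<in>E - E0. cinner (S f) f)"
      using sum.subset_diff[OF E(1,2), of "\<lambda>f. cinner (S f) f"] by (simp add: trace_on_def)
    then have "cmod (\<Sum>j<n. s j) \<le> cmod (trace_on E S) + cmod (\<Sum>f\<in>E - E0. cinner (S f) f)"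
      by (simp add: norm_triangle_ineq4)
    also have "\<dots> \<le> C * real (card E) * g (real n) + real (card E) * (\<bar>B\<bar> * g (real n))"
    proof (rule add_mono)
      show "cmod (trace_on E S) \<le> C * real (card E) * g (real n)" by (rule F(3)[OF E(2-4)])
      have "cmod (\<Sum>f\<in>E - E0. cinner (S f) f) \<le> (\<Sum>f\<in>E - E0. \<bar>B\<bar> * g (real n))"
      proof (intro order_trans[OF norm_sum] sum_mono)
        fix f assume f: "f \<in> E - E0"
        have "cinner f (e i) = 0" if "i < n" for i
        proof -
          have "e i \<in> E0" using that by (simp add: E0_def)
          then show ?thesis using f E(1,3) by (auto simp: orthonormal_set_def)
        qed
        then have "cmod (cinner (S f) f) \<le> B * g (real n)"
          using bn f orthonormal_set_norm[OF E(3)] by simp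
        also have "\<dots> \<le> \<bar>B\<bar> * g (real n)" using less_imp_le[OF g[of n]] by (intro mult_right_mono) auto
        finally show "cmod (cinner (S f) f) \<le> \<bar>B\<bar> * g (real n)" .
      qed
      also have "\<dots> \<le> real (card E) * (\<bar>B\<bar> * g (real n))"
        using less_imp_le[OF g[of n]] card_mono[OF E(2), of "E - E0"] by (simp add: mult_right_mono)
      finally show "cmod (\<Sum>f\<in>E - E0. cinner (S f) f) \<le> real (card E) * (\<bar>B\<bar> * g (real n))" .
    qed
    also have "\<dots> = real (card E) * ((C + \<bar>B\<bar>) * g (real n))" by (simp add: algebra_simps)
    also have "\<dots> \<le> (1 + C) * real n * ((C + \<bar>B\<bar>) * g (real n))"
      using cE C(1) less_imp_le[OF g[of n]] by (intro mult_right_mono) auto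
    also have "\<dots> = D * (real n * g (real n))" by (simp add: D_def)
    finally show "cmod (\<Sum>j<n. s j) \<le> D * (real n * g (real n))" .
  qed
  moreover have "D \<ge> 0" using C(1) by (simp add: D_def)
  ultimately show ?thesis by blast
qed

section \<open>The operators \<open>T\<^sub>g\<close>\<close>

text \<open>An \<open>RV\<close>-function of index \<open>-1\<close> need not decrease from the start, so its values are only the singular
  values up to order. As they tend to \<open>0\<close>, it suffices to sort finitely many of them, and the growth
  condition defining the ideal does not see the difference.\<close>

lemma decreasing_rearrangement:
  fixes a :: "nat \<Rightarrow> real"
  assumes pos: "\<And>n. 0 < a n" and lim: "a \<longlonglongrightarrow> 0" and dec: "\<And>m n. N \<le> m \<Longrightarrow> m \<le> n \<Longrightarrow> a n \<le> a m"
  obtains \<pi> M where "bij \<pi>" "antimono (\<lambda>n. a (\<pi> n))" "\<And>n. M \<le> n \<Longrightarrow> \<pi> n = n"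
proof -
  define c where "c = Min (a ` {..N})"
  have cpos: "c > 0" unfolding c_def using pos by (subst Min_gr_iff) auto
  obtain M0 where M0: "\<And>n. n \<ge> M0 \<Longrightarrow> a n < c"
    using order_tendstoD(2)[OF lim cpos] by (auto simp: eventually_sequentially)
  define M where "M = max M0 N"
  have split: "a j \<le> a i" if "i < M" "M \<le> j" for i j
  proof (cases "i \<le> N")
    case True
    then have "c \<le> a i" unfolding c_def by (intro Min_le) auto
    then show ?thesis using M0[of j] that by (simp add: M_def)
  next
    case False
    then show ?thesis using that by (intro dec) auto
  qed
  define ys where "ys = sort_key (\<lambda>i. - a i) [0..<M]"
  have ys: "length ys = M" "distinct ys" "set ys = {0..<M}" "sorted (map (\<lambda>i. - a i) ys)"
    by (simp_all add: ys_def)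
  define \<pi> where "\<pi> i = (if i < M then ys ! i else i)" for i
  have in_M: "ys ! i < M" if "i < M" for i using nth_mem[of i ys] that ys by auto
  have "inj \<pi>"
  proof (rule injI)
    fix i j assume "\<pi> i = \<pi> j"
    then show "i = j" using in_M[of i] in_M[of j] ys nth_eq_iff_index_eq[of ys i j]
      by (auto simp: \<pi>_def split: if_splits)
  qed
  moreover have "surj \<pi>"
  proof (rule surjI)
    fix k
    have "\<exists>i. \<pi> i = k"
    proof (cases "k < M")
      case True
      then obtain i where "i < M" "ys ! i = k" using ys by (metis atLeastLessThan_iff in_set_conv_nth le0)
      then show ?thesis by (auto simp: \<pi>_def)
    qed (auto simp: \<pi>_def)
    then show "\<pi> (SOME i. \<pi> i = k) = k" by (rule someI_ex)
  qed
  ultimately have "bij \<pi>" by (simp add: bij_def)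
  moreover have "antimono (\<lambda>n. a (\<pi> n))"
  proof (rule antimonoI)
    fix i j :: nat assume ij: "i \<le> j"
    consider "j < M" | "i < M" "M \<le> j" | "M \<le> i" using ij by linarith
    then show "a (\<pi> j) \<le> a (\<pi> i)"
    proof cases
      case 1
      then show ?thesis using sorted_nth_mono[OF ys(4) ij] ij ys(1) by (simp add: \<pi>_def)
    next
      case 2
      then show ?thesis using split[OF in_M[OF 2(1)] 2(2)] by (simp add: \<pi>_def)
    next
      case 3
      then have "N \<le> i" "\<not> i < M" "\<not> j < M" using ij by (auto simp: M_def)
      then show ?thesis using ij by (simp add: \<pi>_def dec)
    qed
  qed
  ultimately show thesis using that[of \<pi> M] by (simp add: \<pi>_def)
qed

lemma bounded_seq_of_null: "a \<longlonglongrightarrow> (0::real) \<Longrightarrow> \<exists>B. \<forall>j. \<bar>a j\<bar> \<le> B"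
  by (metis Bseq_def convergentI convergent_imp_Bseq real_norm_def)

lemma series_op_in_ideal:
  assumes u: "orthonormal_seq u" and v: "orthonormal_seq v" and pos: "\<And>n. 0 < g (real n)"
    and lim: "(\<lambda>n. g (real n)) \<longlonglongrightarrow> 0"
    and dec: "\<And>m n. N \<le> m \<Longrightarrow> m \<le> n \<Longrightarrow> g (real n) \<le> g (real m)"
  shows "series_op (\<lambda>n. g (real n)) u v \<in> weak_lorentz_ideal g"
proof -
  define a where "a n = g (real n)" for n
  obtain B where B: "\<And>j. \<bar>a j\<bar> \<le> B" using bounded_seq_of_null[OF lim] by (auto simp: a_def)
  have cpt: "compact_op (series_op a u v)"
    using lim by (intro compact_op_series_op[OF u v B]) (simp add: a_def[abs_def])
  define P where "P = series_op (\<lambda>j. a j * a j) u u"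
  have comp: "adjoint_op (series_op a u v) \<circ> series_op a u v = P"
    unfolding adjoint_series_op[OF u v B] P_def
    by (rule ext) (simp add: series_op_comp[OF u v B])
  obtain \<pi> M where \<pi>: "bij \<pi>" "antimono (\<lambda>n. a (\<pi> n))" "\<And>n. M \<le> n \<Longrightarrow> \<pi> n = n"
    using decreasing_rearrangement[of a N] pos lim dec by (auto simp: a_def[abs_def])
  define l where "l j = a (\<pi> j) * a (\<pi> j)" for j
  have BB: "\<bar>a j * a j\<bar> \<le> B * B" for j
    unfolding abs_mult using B[of j] by (intro mult_mono) auto
  have pos': "positive_op P"
    unfolding comp[symmetric] by (rule compact_positive_adjoint_comp[OF cpt])
  have "eigenvalue_sequence P l"
  proof (rule eigenvalue_sequenceI[where e = "u \<circ> \<pi>"])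
    show "bounded_op P" unfolding P_def by (rule bounded_op_series_op[OF u u BB])
    show "cinner (P x) y = cinner x (P y)" for x y by (rule positive_op_selfadjoint[OF pos'])
    show "orthonormal_seq (u \<circ> \<pi>)"
      using u bij_is_inj[OF \<pi>(1)] by (simp add: orthonormal_seq_def inj_eq)
    show "P ((u \<circ> \<pi>) j) = l j *\<^sub>R (u \<circ> \<pi>) j" for j
      unfolding P_def l_def by (simp add: series_op_basis[OF u u BB])
    show "P y = 0" if "\<And>j. cinner y ((u \<circ> \<pi>) j) = 0" for y
    proof -
      have "cinner y (u j) = 0" for j
        using that[of "inv \<pi> j"] \<pi>(1) by (simp add: bij_is_surj surj_f_inv_f)
      then show ?thesis by (simp add: P_def series_op_def)
    qed
    show "antimono l"
      using \<pi>(2) pos unfolding antimono_def l_def a_def by (auto intro!: mult_mono simp: less_imp_le)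
    show "0 \<le> l j" for j by (simp add: l_def)
    have "(\<lambda>j. a j * a j) \<longlonglongrightarrow> 0 * 0" unfolding a_def by (intro tendsto_mult lim)
    moreover have "\<forall>\<^sub>F j in sequentially. a j * a j = l j"
      using eventually_ge_at_top[of M] by eventually_elim (simp add: l_def \<pi>(3))
    ultimately show "l \<longlonglongrightarrow> 0" by (simp add: tendsto_cong)
  qed
  then have sv: "singval (series_op a u v) j = a (\<pi> j)" for j
    unfolding singval_def comp using pos by (simp add: eigval_eqI l_def a_def less_imp_le)
  have "\<forall>\<^sub>F j in sequentially. norm (singval (series_op a u v) j) \<le> 1 * norm (g (real j))"
    using eventually_ge_at_top[of M] by eventually_elim (simp add: sv \<pi>(3) a_def)
  then have "singval (series_op a u v) \<in> O(\<lambda>j. g (real j))" by (rule bigoI)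
  then show ?thesis using cpt unfolding weak_lorentz_ideal_def a_def[abs_def] by simp
qed

lemma bounded_op_eq_of_basis:
  assumes \<xi>: "orthonormal_basis \<xi>" and A: "bounded_op A" and B: "bounded_op B"
    and eq: "\<And>j. A (\<xi> j) = B (\<xi> j)"
  shows "A = B"
proof -
  have "closed {x. A x = B x}"
    using A B by (intro closed_Collect_eq linear_continuous_on) (auto simp: bounded_op_def)
  moreover have "cspan (range \<xi>) \<subseteq> {x. A x = B x}"
  proof
    fix x assume "x \<in> cspan (range \<xi>)"
    then show "x \<in> {x. A x = B x}"
      by (induction rule: complex_vector.span_induct_alt)
        (auto simp: bounded_op_add[OF A] bounded_op_add[OF B] bounded_op_cscale[OF A]
          bounded_op_cscale[OF B] bounded_op_zero[OF A] bounded_op_zero[OF B] eq)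
  qed
  ultimately have "closure (cspan (range \<xi>)) \<subseteq> {x. A x = B x}" by (intro closure_minimal)
  then show ?thesis using \<xi> by (auto simp: orthonormal_basis_def)
qed

text \<open>With the isometry \<open>V\<close> mapping the basis \<open>\<xi>\<close> of \<open>S\<close> to \<open>e\<close> and \<open>K = S V\<^sup>*\<close>, which lies in the
  ideal, the two diagonal operators are \<open>V K\<close> and \<open>K V\<close>. So eigenvectors \<open>e\<close> of another operator, which
  may span a proper subspace, can replace the basis in the study of traces.\<close>

lemma T_g_commutator_equivalent:
  assumes S: "is_T_g g S" and e: "orthonormal_seq e" and pos: "\<And>n. 0 < g (real n)"
    and lim: "(\<lambda>n. g (real n)) \<longlonglongrightarrow> 0"
    and dec: "\<And>m n. N \<le> m \<Longrightarrow> m \<le> n \<Longrightarrow> g (real n) \<le> g (real m)"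
  shows "series_op (\<lambda>n. g (real n)) e e - S \<in> com_space g"
proof -
  define a where "a n = g (real n)" for n
  obtain \<xi> where \<xi>: "orthonormal_basis \<xi>" and S\<xi>: "\<And>j. S (\<xi> j) = a j *\<^sub>R \<xi> j" and bS: "bounded_op S"
    using S by (auto simp: is_T_g_def a_def)
  have x: "orthonormal_seq \<xi>" using \<xi> by (simp add: orthonormal_basis_def orthonormal_seq_def)
  obtain B where B: "\<And>j. \<bar>a j\<bar> \<le> B" using bounded_seq_of_null[OF lim] by (auto simp: a_def)
  have SS: "S = series_op a \<xi> \<xi>"
    by (rule bounded_op_eq_of_basis[OF \<xi> bS bounded_op_series_op[OF x x B]])
      (simp add: S\<xi> series_op_basis[OF x x B])
  define V where "V = series_op (\<lambda>_. 1) \<xi> e"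
  define K where "K = series_op a e \<xi>"
  have one: "\<bar>1\<bar> \<le> (1::real)" for j :: nat by simp
  have "V (K y) = series_op a e e y" "K (V y) = S y" for y
    unfolding V_def K_def SS
    by (simp_all add: series_op_comp[OF e x B] series_op_comp[OF x e one])
  then have "series_op a e e - S = (\<lambda>y. V (K y) - K (V y))" by auto
  moreover have "bounded_op V" unfolding V_def by (rule bounded_op_series_op[OF x e one])
  moreover have "K \<in> weak_lorentz_ideal g"
    unfolding K_def a_def[abs_def] by (rule series_op_in_ideal[OF e x pos lim dec])
  ultimately show ?thesis
    unfolding com_space_def a_def[abs_def] by (intro fun_space.span_base) blast
qed

text \<open>A linear functional that vanishes on the commutators can be prescribed on two operators that
  are independent modulo commutators; normalising it on one diagonal operator normalises it on
  all operators \<open>T\<^sub>g\<close>.\<close>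

lemma not_hypermeasurable_of_independent:
  fixes T :: "'a::complex_hilbert_space \<Rightarrow> 'a"
  assumes e: "orthonormal_seq e" and pos: "\<And>n. 0 < g (real n)"
    and lim: "(\<lambda>n. g (real n)) \<longlonglongrightarrow> 0"
    and dec: "\<And>m n. N \<le> m \<Longrightarrow> m \<le> n \<Longrightarrow> g (real n) \<le> g (real m)"
    and indep: "\<And>a b. fscale a T + fscale b (series_op (\<lambda>n. g (real n)) e e) \<in> com_space g \<Longrightarrow>
      a = 0 \<and> b = 0"
  shows "\<not> hypermeasurable g T"
proof -
  define S where "S = series_op (\<lambda>n. g (real n)) e e"
  have sub: "fun_space.subspace (com_space g :: ('a \<Rightarrow> 'a) set)"
    unfolding com_space_def by (rule fun_space.subspace_span)
  obtain B :: "('a \<Rightarrow> 'a) set" where B0: "B \<subseteq> com_space g" "fun_space.independent B" "com_space g \<subseteq> fun_space.span B"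
    by (rule fun_space.basis_exists)
  have B: "fun_space.independent B" "fun_space.span B = com_space g"
    using B0(2) fun_space.span_subspace[OF B0(1,3) sub] by auto
  have one: "fscale 1 X = X" and zero: "fscale 0 X = 0" for X :: "'a \<Rightarrow> 'a"
    by (simp_all add: fscale_def fun_eq_iff)
  have S: "S \<notin> fun_space.span B"
    using indep[of 0 1] unfolding B(2) by (auto simp: S_def one zero)
  have T: "T \<notin> fun_space.span (insert S B)"
  proof
    assume "T \<in> fun_space.span (insert S B)"
    then obtain k where "T - fscale k S \<in> com_space g"
      unfolding fun_space.span_breakdown_eq B(2) by blast
    moreover have "T - fscale k S = fscale 1 T + fscale (- k) S"
      by (simp add: fscale_def fun_eq_iff complex_vector.scale_minus_left)
    ultimately show False using indep[of 1 "- k"] by (simp add: S_def)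
  qed
  have ind: "fun_space.independent (insert T (insert S B))"
    using B(1) S T by (simp add: fun_space.independent_insert fun_space.span_base)
  have ne: "S \<noteq> T" "S \<notin> B" "T \<notin> B" using S T fun_space.span_base[of _ "insert S B"] fun_space.span_base[of _ B] by auto
  have "\<exists>\<phi>. normalized_trace g \<phi> \<and> \<phi> T = z" for z
  proof -
    have "\<exists>\<phi>. Vector_Spaces.linear fscale (*) \<phi> \<and>
        (\<forall>X\<in>insert T (insert S B). \<phi> X = (if X = T then z else if X = S then 1 else 0))"
      by (rule fun_functional.linear_independent_extend[OF ind])
    then obtain \<phi> where \<phi>: "Vector_Spaces.linear fscale (*) \<phi>"
      "\<And>X. X \<in> insert T (insert S B) \<Longrightarrow> \<phi> X = (if X = T then z else if X = S then 1 else 0)"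
      by blast
    interpret \<phi>: Vector_Spaces.linear fscale "(*)" \<phi> by (rule \<phi>(1))
    have "\<phi> X = 0" if "X \<in> B" for X using \<phi>(2)[of X] that ne by auto
    then have com: "\<phi> X = 0" if "X \<in> com_space g" for X
      using fun_functional.linear_eq_0_on_span[OF \<phi>(1)] that B(2) by blast
    have "\<phi> (\<lambda>x. X x + Y x) = \<phi> X + \<phi> Y" for X Y
      using \<phi>.add[of X Y] by (simp add: plus_fun_def)
    moreover have "\<phi> (\<lambda>x. cscale c (X x)) = c * \<phi> X" for c X
      using \<phi>.scale[of c X] by (simp add: fscale_def)
    moreover have "\<phi> (\<lambda>x. A (X x) - X (A x)) = 0" if "bounded_op A" "X \<in> weak_lorentz_ideal g" for A X
      by (rule com) (use that in \<open>auto simp: com_space_def intro!: fun_space.span_base\<close>)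
    ultimately have "is_trace g \<phi>" by (simp add: is_trace_def)
    moreover have "\<phi> S' = 1" if "is_T_g g S'" for S'
    proof -
      have "\<phi> (S - S') = 0"
        unfolding S_def by (rule com[OF T_g_commutator_equivalent[OF that e pos lim dec]])
      then show ?thesis using \<phi>(2)[of S] ne by (simp add: \<phi>.diff)
    qed
    ultimately have "normalized_trace g \<phi>" by (simp add: normalized_trace_def)
    then show ?thesis using \<phi>(2)[of T] by auto
  qed
  from this[of 0] this[of 1] show ?thesis unfolding hypermeasurable_def by (metis zero_neq_one)
qed

section \<open>Regularly varying functions of index \<open>-1\<close>\<close>

text \<open>An increasing function has \<open>g(2 t) / g(t) \<ge> 1\<close>, but this quotient tends to \<open>1/2\<close>.\<close>

lemma RV_minus_one_eventually_antimono:
  assumes "RV_minus_one g"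
  shows "\<exists>a\<ge>0. antimono_on {a..} g"
proof -
  obtain a where a: "a \<ge> 0" "mono_on {a..} g \<or> antimono_on {a..} g"
    using assms by (auto simp: RV_minus_one_def)
  have "\<not> mono_on {a..} g"
  proof
    assume m: "mono_on {a..} g"
    have "((\<lambda>t. g (2 * t) / g t) \<longlongrightarrow> inverse 2) at_top"
      using assms unfolding RV_minus_one_def by (blast intro: zero_less_numeral)
    moreover have "\<forall>\<^sub>F t in at_top. 1 \<le> g (2 * t) / g t"
      using eventually_ge_at_top[of a]
    proof eventually_elim
      fix t assume t: "a \<le> t"
      then have "g t \<le> g (2 * t)" using a(1) by (intro monotone_onD[OF m]) auto
      moreover have "0 < g t" using assms t a(1) by (simp add: RV_minus_one_def)
      ultimately show "1 \<le> g (2 * t) / g t" by simp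
    qed
    ultimately have "1 \<le> inverse (2::real)" by (intro tendsto_lowerbound) auto
    then show False by simp
  qed
  then show ?thesis using a by blast
qed

text \<open>Eventually each doubling of the argument multiplies \<open>g\<close> by at most \<open>3/4\<close>, and \<open>g\<close> decreases in
  between.\<close>

lemma RV_minus_one_tendsto_zero:
  assumes g: "RV_minus_one g"
  shows "(g \<longlongrightarrow> 0) at_top"
proof -
  have pos: "0 < g t" if "0 \<le> t" for t using g that by (simp add: RV_minus_one_def)
  obtain a where a: "a \<ge> 0" "antimono_on {a..} g" using RV_minus_one_eventually_antimono[OF g] by blast
  have "((\<lambda>t. g (2 * t) / g t) \<longlongrightarrow> inverse 2) at_top"
    using g unfolding RV_minus_one_def by (blast intro: zero_less_numeral)
  then have "\<forall>\<^sub>F t in at_top. g (2 * t) / g t < 3 / 4" by (rule order_tendstoD) simp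
  then obtain b where b: "\<And>t. b \<le> t \<Longrightarrow> g (2 * t) / g t < 3 / 4"
    by (auto simp: eventually_at_top_linorder)
  define c where "c = max (max a b) 1"
  have c: "c \<ge> a" "c \<ge> b" "c \<ge> 1" by (auto simp: c_def)
  have half: "g (2 ^ n * c) \<le> (3 / 4) ^ n * g c" for n
  proof (induction n)
    case (Suc n)
    have "c \<le> 2 ^ n * c" using mult_right_mono[of 1 "2 ^ n" c] c by simp
    then have "b \<le> 2 ^ n * c" "0 \<le> 2 ^ n * c" using c by linarith+
    then have "g (2 * (2 ^ n * c)) \<le> 3 / 4 * g (2 ^ n * c)"
      using b[of "2 ^ n * c"] pos[of "2 ^ n * c"] by (simp add: field_simps)
    also have "\<dots> \<le> 3 / 4 * ((3 / 4) ^ n * g c)" using Suc by simp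
    finally show ?case by (simp add: mult.assoc)
  qed simp
  show ?thesis
  proof (rule tendstoI)
    fix e :: real assume e: "e > 0"
    have "(\<lambda>n. (3 / 4) ^ n * g c) \<longlonglongrightarrow> 0 * g c" by (intro tendsto_intros LIMSEQ_realpow_zero) auto
    then have "\<forall>\<^sub>F n in sequentially. (3 / 4) ^ n * g c < e" using e by (intro order_tendstoD) auto
    then obtain n where n: "(3 / 4) ^ n * g c < e" by (auto simp: eventually_sequentially)
    show "\<forall>\<^sub>F t in at_top. dist (g t) 0 < e"
      using eventually_ge_at_top[of "2 ^ n * c"]
    proof eventually_elim
      fix t assume t: "2 ^ n * c \<le> t"
      have "c \<le> 2 ^ n * c" using mult_right_mono[of 1 "2 ^ n" c] c by simp
      then have "a \<le> 2 ^ n * c" using c by linarith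
      then have "g t \<le> g (2 ^ n * c)" using t by (intro monotone_onD[OF a(2)]) auto
      moreover have "0 < g t" using \<open>a \<le> 2 ^ n * c\<close> a(1) t by (intro pos) linarith
      ultimately show "dist (g t) 0 < e" using half[of n] n by simp
    qed
  qed
qed

section \<open>Growth of the eigenvalue sums\<close>

text \<open>On \<open>[j, j + 1]\<close> with \<open>j \<ge> J\<close> the integrand is at most \<open>h j\<close>.\<close>

lemma integral_le_sum_decreasing:
  fixes h :: "real \<Rightarrow> real"
  assumes int: "\<And>t. t\<^sub>0 \<le> t \<Longrightarrow> h integrable_on {t\<^sub>0..t}" and J: "t\<^sub>0 \<le> real J"
    and dec: "\<And>s t. real J \<le> s \<Longrightarrow> s \<le> t \<Longrightarrow> h t \<le> h s" and n: "J \<le> n"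
  shows "integral {t\<^sub>0..real n} h \<le> integral {t\<^sub>0..real J} h + (\<Sum>j=J..<n. h (real j))"
  using n
proof (induction n rule: dec_induct)
  case base
  show ?case by simp
next
  case (step n)
  have sub: "h integrable_on {real n..real (Suc n)}"
    using J step(1) by (intro integrable_subinterval_real[OF int[of "real (Suc n)"]]) auto
  have "integral {t\<^sub>0..real (Suc n)} h = integral {t\<^sub>0..real n} h + integral {real n..real (Suc n)} h"
    using J step(1) by (intro Henstock_Kurzweil_Integration.integral_combine[symmetric] int) auto
  also have "integral {real n..real (Suc n)} h \<le> integral {real n..real (Suc n)} (\<lambda>_. h (real n))"
    using step(1) by (intro integral_le[OF sub]) (auto intro: dec)
  also have "\<dots> = h (real n)" by simp
  finally show ?case using step by simp
qed

text \<open>Here \<open>w\<close> and \<open>x\<close> stand for \<open>g\<close> and \<open>\<epsilon>\<close> at the integers. The combination \<open>a lam j + b w j\<close> equals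
  \<open>w j (\<kappa> + a \<sigma> x j + o(x j))\<close> with \<open>\<kappa> = a c\<^sub>0 + b\<close>. If \<open>\<kappa> \<noteq> 0\<close>, it eventually points roughly in the
  direction of \<open>\<kappa>\<close>, and otherwise in that of \<open>a \<sigma>\<close>; the fixed sign \<open>\<sigma>\<close> excludes cancellation.\<close>

lemma weights_one_sided:
  fixes a b :: complex and c\<^sub>0 \<sigma> :: real and x r lam w :: "nat \<Rightarrow> real"
  assumes ab: "a \<noteq> 0 \<or> b \<noteq> 0" and \<sigma>: "\<sigma> \<in> {1, -1}"
    and x: "\<forall>\<^sub>F j in sequentially. 0 < x j" "x \<longlonglongrightarrow> 0" and r: "r \<in> o(x)" and w: "\<And>j. 0 < w j"
    and lam: "\<forall>\<^sub>F j in sequentially. lam j = w j * (c\<^sub>0 + \<sigma> * x j + r j)"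
  shows "\<exists>\<omega> \<delta>. 0 < \<delta> \<and> (\<forall>\<^sub>F j in sequentially. \<delta> * (x j * w j) \<le>
    Re (\<omega> * (a * complex_of_real (lam j) + b * complex_of_real (w j))))"
proof -
  define \<kappa> where "\<kappa> = a * complex_of_real c\<^sub>0 + b"
  have eq: "\<omega> * (a * complex_of_real (lam j) + b * complex_of_real (w j))
      = complex_of_real (w j) * (\<omega> * \<kappa> + \<omega> * a * complex_of_real (\<sigma> * x j + r j))"
    if "lam j = w j * (c\<^sub>0 + \<sigma> * x j + r j)" for \<omega> j
    unfolding that \<kappa>_def by (simp add: algebra_simps)
  have rx: "\<forall>\<^sub>F j in sequentially. \<bar>r j\<bar> \<le> (1 / 2) * \<bar>x j\<bar>"
    using landau_o.smallD[OF r, of "1 / 2"] by simp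
  show ?thesis
  proof (cases "\<kappa> = 0")
    case True
    then have "a \<noteq> 0" using ab by (auto simp: \<kappa>_def)
    define \<omega> where "\<omega> = cnj a * complex_of_real \<sigma>"
    have \<omega>a: "\<omega> * a = complex_of_real (\<sigma> * (cmod a)\<^sup>2)"
      unfolding \<omega>_def using complex_norm_square[of a] by (simp add: mult_ac)
    have "\<forall>\<^sub>F j in sequentially. (cmod a)\<^sup>2 / 2 * (x j * w j) \<le>
        Re (\<omega> * (a * complex_of_real (lam j) + b * complex_of_real (w j)))"
      using rx x(1) lam
    proof eventually_elim
      fix j assume j: "\<bar>r j\<bar> \<le> 1 / 2 * \<bar>x j\<bar>" "0 < x j" "lam j = w j * (c\<^sub>0 + \<sigma> * x j + r j)"
      have "x j / 2 \<le> \<sigma> * (\<sigma> * x j + r j)" using j(1,2) \<sigma> by auto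
      then have "(w j * (cmod a)\<^sup>2) * (x j / 2) \<le> (w j * (cmod a)\<^sup>2) * (\<sigma> * (\<sigma> * x j + r j))"
        using w[of j] by (intro mult_left_mono) auto
      also have "\<dots> = Re (complex_of_real (w j) * (\<omega> * \<kappa> + \<omega> * a * complex_of_real (\<sigma> * x j + r j)))"
        unfolding True \<omega>a by (simp flip: of_real_mult of_real_add)
      finally show "(cmod a)\<^sup>2 / 2 * (x j * w j) \<le>
          Re (\<omega> * (a * complex_of_real (lam j) + b * complex_of_real (w j)))"
        unfolding eq[OF j(3)] by (simp add: mult_ac)
    qed
    then show ?thesis using \<open>a \<noteq> 0\<close>
      by (intro exI[of _ \<omega>] exI[of _ "(cmod a)\<^sup>2 / 2"]) auto
  next
    case False
    define k where "k = cmod \<kappa>"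
    have k: "k > 0" using False by (simp add: k_def)
    have "\<forall>\<^sub>F j in sequentially. x j < k / (2 * cmod a + 1)"
      using k by (intro order_tendstoD[OF x(2)]) (simp add: add_nonneg_pos)
    then have "\<forall>\<^sub>F j in sequentially. k * (x j * w j) \<le>
        Re (cnj \<kappa> * (a * complex_of_real (lam j) + b * complex_of_real (w j)))"
      using rx x(1) lam
    proof eventually_elim
      fix j assume j: "x j < k / (2 * cmod a + 1)" "\<bar>r j\<bar> \<le> 1 / 2 * \<bar>x j\<bar>" "0 < x j"
        "lam j = w j * (c\<^sub>0 + \<sigma> * x j + r j)"
      have "x j * (2 * cmod a + 1) < k"
        using j(1) by (subst (asm) pos_less_divide_eq) (simp_all add: add_nonneg_pos)
      then have small: "k * (x j * (2 * cmod a + 1)) \<le> k * k" using k by simp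
      have \<kappa>\<kappa>: "cnj \<kappa> * \<kappa> = complex_of_real (k * k)"
        using complex_norm_square[of \<kappa>] by (simp add: k_def mult.commute power2_eq_square)
      have "\<bar>\<sigma> * x j + r j\<bar> \<le> 2 * x j" using j(2,3) \<sigma> by auto
      then have "cmod (cnj \<kappa> * a * complex_of_real (\<sigma> * x j + r j)) \<le> k * cmod a * (2 * x j)"
        unfolding norm_mult norm_of_real k_def complex_mod_cnj by (intro mult_mono) auto
      then have "- (k * cmod a * (2 * x j)) \<le> Re (cnj \<kappa> * a * complex_of_real (\<sigma> * x j + r j))"
        using abs_Re_le_cmod[of "cnj \<kappa> * a * complex_of_real (\<sigma> * x j + r j)"] by linarith
      then have "k * x j \<le> Re (cnj \<kappa> * \<kappa> + cnj \<kappa> * a * complex_of_real (\<sigma> * x j + r j))"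
        unfolding \<kappa>\<kappa> using small by (simp add: algebra_simps)
      then have "w j * (k * x j)
          \<le> w j * Re (cnj \<kappa> * \<kappa> + cnj \<kappa> * a * complex_of_real (\<sigma> * x j + r j))"
        using w[of j] by (intro mult_left_mono) auto
      also have "\<dots> = Re (complex_of_real (w j) * (cnj \<kappa> * \<kappa> + cnj \<kappa> * a * complex_of_real (\<sigma> * x j + r j)))"
        by simp
      finally show "k * (x j * w j) \<le>
          Re (cnj \<kappa> * (a * complex_of_real (lam j) + b * complex_of_real (w j)))"
        unfolding eq[OF j(4)] by (simp add: mult_ac)
    qed
    then show ?thesis using k by blast
  qed
qed

text \<open>Weights that dominate \<open>\<epsilon> g\<close> in one direction have partial sums of at least the order of
  \<open>I(n) = \<integral> \<epsilon> g\<close>, whereas \<open>n g(n) = o(I(n))\<close>. So a bound \<open>O(n g(n))\<close> would keep \<open>I\<close> bounded, and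
  \<open>n g(n)\<close> would tend to \<open>0\<close>, against \<open>1/n = O(g(n))\<close>.\<close>

lemma eigenvalue_sums_not_small:
  fixes g \<epsilon> :: "real \<Rightarrow> real" and s :: "nat \<Rightarrow> complex"
  assumes pos: "\<And>t. 0 \<le> t \<Longrightarrow> 0 < g t" and dec: "antimono_on {a..} g"
    and low: "(\<lambda>t. 1 / t) \<in> O[at_top](g)"
    and t0: "0 \<le> t\<^sub>0" and \<epsilon>: "\<And>t. t\<^sub>0 \<le> t \<Longrightarrow> 0 < \<epsilon> t" "antimono_on {t\<^sub>0..} \<epsilon>"
    and small: "(\<lambda>t. t * g t) \<in> o[at_top](\<lambda>t. integral {t\<^sub>0..t} (\<lambda>s. \<epsilon> s * g s))"
    and \<delta>: "0 < \<delta>" "\<forall>\<^sub>F j in sequentially. \<delta> * (\<epsilon> (real j) * g (real j)) \<le> Re (\<omega> * s j)"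
  shows "\<not> (\<exists>D\<ge>0. \<forall>\<^sub>F n in sequentially. cmod (\<Sum>j<n. s j) \<le> D * (real n * g (real n)))"
proof
  define h where "h t = \<epsilon> t * g t" for t
  define I where "I t = integral {t\<^sub>0..t} h" for t
  assume "\<exists>D\<ge>0. \<forall>\<^sub>F n in sequentially. cmod (\<Sum>j<n. s j) \<le> D * (real n * g (real n))"
  then obtain D where D: "D \<ge> 0" "\<forall>\<^sub>F n in sequentially. cmod (\<Sum>j<n. s j) \<le> D * (real n * g (real n))"
    by blast
  have h0: "0 \<le> h t" if "t\<^sub>0 \<le> t" for t
    using that pos[of t] \<epsilon>(1)[of t] t0 unfolding h_def by (intro mult_nonneg_nonneg) auto
  have small: "\<forall>\<^sub>F t in at_top. \<bar>t * g t\<bar> \<le> c * \<bar>I t\<bar>" if "c > 0" for c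
    using landau_o.smallD[OF small that] by (simp add: I_def h_def[abs_def])
  \<comment> \<open>A function without an integral has integral \<open>0\<close>, so the smallness hypothesis provides integrability.\<close>
  have int: "h integrable_on {t\<^sub>0..t}" if "t\<^sub>0 \<le> t" for t
  proof -
    have "\<forall>\<^sub>F u in at_top. h integrable_on {t\<^sub>0..u} \<and> t \<le> u"
      using small[of 1, OF zero_less_one] eventually_ge_at_top[of "max t 1"]
    proof eventually_elim
      fix u assume u: "\<bar>u * g u\<bar> \<le> 1 * \<bar>I u\<bar>" "max t 1 \<le> u"
      have "0 < u * g u" using u(2) pos[of u] by simp
      then have "I u \<noteq> 0" using u(1) by auto
      then show "h integrable_on {t\<^sub>0..u} \<and> t \<le> u"
        using u(2) not_integrable_integral[of h "{t\<^sub>0..u}"] by (auto simp: I_def)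
    qed
    then obtain u where u: "h integrable_on {t\<^sub>0..u}" "t \<le> u"
      by (auto dest!: eventually_happens)
    show ?thesis by (rule integrable_subinterval_real[OF u(1)]) (use u(2) in auto)
  qed
  have I0: "0 \<le> I t" if "t\<^sub>0 \<le> t" for t
    unfolding I_def using int[OF that] h0 by (intro integral_nonneg) auto
  from \<delta>(2) obtain J0 where J0: "\<And>j. j \<ge> J0 \<Longrightarrow> \<delta> * h (real j) \<le> Re (\<omega> * s j)"
    unfolding eventually_sequentially h_def by blast
  obtain J1 :: nat where J1: "max t\<^sub>0 a \<le> real J1" using real_arch_simple by blast
  define J where "J = max J0 J1"
  have J: "t\<^sub>0 \<le> real J" "a \<le> real J" "J0 \<le> J" using J1 by (auto simp: J_def)
  have hdec: "h t \<le> h u" if "real J \<le> u" "u \<le> t" for u t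
  proof -
    have "\<epsilon> t \<le> \<epsilon> u" using that J by (intro monotone_onD[OF \<epsilon>(2)]) auto
    moreover have "g t \<le> g u" using that J by (intro monotone_onD[OF dec]) auto
    ultimately show ?thesis unfolding h_def
      using that J t0 pos[of t] \<epsilon>(1)[of u] by (intro mult_mono) auto
  qed
  define C where "C = \<delta> * I (real J) + cmod \<omega> * cmod (\<Sum>j<J. s j)"
  have lower: "\<delta> * I (real n) \<le> C + cmod \<omega> * cmod (\<Sum>j<n. s j)" if n: "J \<le> n" for n
  proof -
    have "I (real n) \<le> I (real J) + (\<Sum>j=J..<n. h (real j))"
      unfolding I_def by (rule integral_le_sum_decreasing[OF int J(1) hdec n])
    then have "\<delta> * I (real n) \<le> \<delta> * (I (real J) + (\<Sum>j=J..<n. h (real j)))"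
      using \<delta>(1) by (intro mult_left_mono) auto
    also have "\<dots> = \<delta> * I (real J) + (\<Sum>j=J..<n. \<delta> * h (real j))"
      by (simp add: distrib_left sum_distrib_left)
    also have "(\<Sum>j=J..<n. \<delta> * h (real j)) \<le> (\<Sum>j=J..<n. Re (\<omega> * s j))"
      using J(3) by (intro sum_mono J0) auto
    also have "\<dots> = Re (\<omega> * (\<Sum>j=J..<n. s j))" by (simp only: sum_distrib_left Re_sum)
    also have "(\<Sum>j=J..<n. s j) = (\<Sum>j<n. s j) - (\<Sum>j<J. s j)"
      using sum.atLeastLessThan_concat[of 0 J n s] n by (simp add: lessThan_atLeast0 algebra_simps)
    also have "Re (\<omega> * \<dots>) = Re (\<omega> * (\<Sum>j<n. s j)) - Re (\<omega> * (\<Sum>j<J. s j))"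
      by (simp only: right_diff_distrib minus_complex.sel)
    also have "\<dots> \<le> cmod (\<omega> * (\<Sum>j<n. s j)) + cmod (\<omega> * (\<Sum>j<J. s j))"
      using abs_Re_le_cmod[of "\<omega> * (\<Sum>j<n. s j)"] abs_Re_le_cmod[of "\<omega> * (\<Sum>j<J. s j)"] by linarith
    finally show ?thesis by (simp add: C_def norm_mult)
  qed
  have C0: "0 \<le> C" using I0[OF J(1)] \<delta>(1) by (simp add: C_def)
  define W where "W = cmod \<omega> * D"
  have W0: "0 \<le> W" using D(1) by (simp add: W_def)
  have seq: "filterlim real at_top sequentially" by (rule filterlim_real_sequentially)
  \<comment> \<open>The constant lets the assumed bound on the partial sums be absorbed by half of \<open>\<delta> I(n)\<close>.\<close>
  have "\<forall>\<^sub>F n in sequentially. \<bar>real n * g (real n)\<bar> \<le> \<delta> / (2 * (W + 1)) * \<bar>I (real n)\<bar>"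
    using \<delta>(1) W0 by (intro eventually_compose_filterlim[OF small seq]) auto
  then have bdd: "\<forall>\<^sub>F n in sequentially. I (real n) \<le> 2 * C / \<delta>"
    using D(2) eventually_ge_at_top[of J]
  proof eventually_elim
    fix n assume n: "\<bar>real n * g (real n)\<bar> \<le> \<delta> / (2 * (W + 1)) * \<bar>I (real n)\<bar>"
      "cmod (\<Sum>j<n. s j) \<le> D * (real n * g (real n))" "J \<le> n"
    have In: "0 \<le> I (real n)" using n(3) J(1) by (intro I0) auto
    have "\<delta> * I (real n) \<le> C + cmod \<omega> * (D * (real n * g (real n)))"
      using lower[OF n(3)] mult_left_mono[OF n(2), of "cmod \<omega>"] by simp
    also have "\<dots> \<le> C + W * (\<delta> / (2 * (W + 1)) * I (real n))"
    proof -
      have "real n * g (real n) \<le> \<delta> / (2 * (W + 1)) * I (real n)"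
        using order_trans[OF abs_ge_self n(1)] unfolding abs_of_nonneg[OF In] .
      from mult_left_mono[OF this W0] show ?thesis by (simp only: W_def mult.assoc add_left_mono)
    qed
    also have "W * (\<delta> / (2 * (W + 1)) * I (real n)) \<le> \<delta> / 2 * I (real n)"
    proof -
      have "W * (\<delta> / (2 * (W + 1)) * I (real n)) \<le> (W + 1) * (\<delta> / (2 * (W + 1)) * I (real n))"
        using \<delta>(1) In W0 by (intro mult_right_mono) auto
      also have "\<dots> = (W + 1) / (W + 1) * (\<delta> / 2 * I (real n))"
        by (simp only: divide_inverse inverse_mult_distrib mult_ac)
      also have "\<dots> = \<delta> / 2 * I (real n)" using W0 by simp
      finally show ?thesis .
    qed
    finally show "I (real n) \<le> 2 * C / \<delta>" using \<delta>(1) by (simp add: field_simps)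
  qed
  obtain c where c: "c > 0" "\<forall>\<^sub>F t in at_top. norm (1 / t) \<le> c * norm (g t)"
    using landau_o.bigE[OF low] by blast
  \<comment> \<open>With this constant, \<open>I(n) \<le> 2 C / \<delta>\<close> forces \<open>n g(n) \<le> 1 / (2 c)\<close>, whereas \<open>n g(n) \<ge> 1 / c\<close>.\<close>
  define \<eta> where "\<eta> = 1 / (2 * c * (2 * C / \<delta> + 1))"
  have M: "0 < 2 * C / \<delta> + 1" using C0 \<delta>(1) by (simp add: add_nonneg_pos)
  then have \<eta>: "\<eta> > 0" using c(1) by (simp add: \<eta>_def)
  have "\<forall>\<^sub>F n in sequentially. False"
    using bdd eventually_compose_filterlim[OF small[OF \<eta>] seq]
      eventually_compose_filterlim[OF c(2) seq] eventually_ge_at_top[of "max J 1"]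
  proof eventually_elim
    fix n :: nat assume n: "I (real n) \<le> 2 * C / \<delta>" "\<bar>real n * g (real n)\<bar> \<le> \<eta> * \<bar>I (real n)\<bar>"
      "norm (1 / real n) \<le> c * norm (g (real n))" "max J 1 \<le> n"
    have "0 \<le> I (real n)" using n(4) J(1) by (intro I0) auto
    then have "\<eta> * \<bar>I (real n)\<bar> \<le> \<eta> * (2 * C / \<delta> + 1)" using n(1) \<eta> by (intro mult_left_mono) auto
    also have "\<dots> = 1 / (2 * c)" using M by (simp add: \<eta>_def)
    finally have "real n * g (real n) \<le> 1 / (2 * c)" using n(2) by linarith
    then have "c * (real n * g (real n)) \<le> 1 / 2" using c(1) by (simp add: field_simps)
    moreover have "1 \<le> c * (real n * g (real n))"
      using n(3,4) pos[of "real n"] by (simp add: field_simps)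
    ultimately show False by linarith
  qed
  then show False by simp
qed

section \<open>Operators that are not hypermeasurable\<close>

theorem proposition3:
  fixes g \<epsilon> :: "real \<Rightarrow> real"
    and T :: "'h::complex_hilbert_space \<Rightarrow> 'h"
    and c\<^sub>0 t\<^sub>0 \<sigma> :: real
    and r :: "nat \<Rightarrow> real"
  assumes "separable_space (euclidean :: 'h topology)"
    and "infinite_dimensional TYPE('h)"
    and "RV_minus_one g"
    and "filterlim (\<lambda>x. integral {0..x} g) at_top at_top"
    and "(\<lambda>t. 1 / t) \<in> O[at_top](g)"
    and "T \<in> weak_lorentz_ideal g"
    and "positive_op T"
    and "\<sigma> \<in> {1, -1}"
    and "0 \<le> t\<^sub>0"
    and "\<forall>t\<ge>t\<^sub>0. 0 < \<epsilon> t"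
    and "antimono_on {t\<^sub>0..} \<epsilon>"
    and "(\<epsilon> \<longlongrightarrow> 0) at_top"
    and "r \<in> o(\<lambda>j. \<epsilon> (real j))"
    and "\<forall>\<^sub>F j in sequentially. eigval T j = g (real j) * (c\<^sub>0 + \<sigma> * \<epsilon> (real j) + r j)"
    and "(\<lambda>t. t * g t) \<in> o[at_top](\<lambda>t. integral {t\<^sub>0..t} (\<lambda>s. \<epsilon> s * g s))"
  shows "\<not> hypermeasurable g T"
proof -
  note inf = assms(2) and lam = assms(14)
  have pos: "0 < g t" if "0 \<le> t" for t using assms(3) that by (simp add: RV_minus_one_def)
  then have posn: "0 < g (real n)" for n by simp
  obtain t\<^sub>1 where t1: "antimono_on {t\<^sub>1..} g" using RV_minus_one_eventually_antimono[OF assms(3)] by blast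
  obtain N :: nat where N: "t\<^sub>1 \<le> real N" using real_arch_simple by blast
  have dec: "g (real n) \<le> g (real m)" if "N \<le> m" "m \<le> n" for m n
    using that N by (intro monotone_onD[OF t1]) auto
  have lim: "(\<lambda>n. g (real n)) \<longlonglongrightarrow> 0"
    by (rule filterlim_compose[OF RV_minus_one_tendsto_zero[OF assms(3)] filterlim_real_sequentially])
  have \<epsilon>lim: "(\<lambda>j. \<epsilon> (real j)) \<longlonglongrightarrow> 0"
    by (rule filterlim_compose[OF assms(12) filterlim_real_sequentially])
  have \<epsilon>pos: "\<forall>\<^sub>F j in sequentially. 0 < \<epsilon> (real j)"
    using eventually_compose_filterlim[OF eventually_ge_at_top[of t\<^sub>0] filterlim_real_sequentially]
    by eventually_elim (use assms(10) in blast)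
  have cpt: "compact_op T" using assms(6) by (simp add: weak_lorentz_ideal_def)
  obtain e where e: "orthonormal_seq e" and l0: "\<And>j. 0 \<le> eigval T j"
    and ev: "\<And>j. T (e j) = eigval T j *\<^sub>R e j"
    and form: "\<And>n y. (\<And>i. i < n \<Longrightarrow> cinner y (e i) = 0) \<Longrightarrow>
      Re (cinner (T y) y) \<le> eigval T n * (norm y)\<^sup>2"
    using eigval_spectral[OF inf cpt assms(7)] by metis
  obtain B where B: "\<And>j. \<bar>g (real j)\<bar> \<le> B" using bounded_seq_of_null[OF lim] by blast
  define S where "S = series_op (\<lambda>n. g (real n)) e e"
  have formT: "\<forall>\<^sub>F n in sequentially. \<forall>f. norm f = 1 \<longrightarrow> (\<forall>i<n. cinner f (e i) = 0) \<longrightarrow>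
      cmod (cinner (T f) f) \<le> (\<bar>c\<^sub>0\<bar> + 2) * g (real n)"
  proof -
    have "\<forall>\<^sub>F j in sequentially. \<bar>r j\<bar> \<le> \<bar>\<epsilon> (real j)\<bar>"
      using landau_o.smallD[OF assms(13), of 1] by simp
    then show ?thesis
      using \<epsilon>pos order_tendstoD(2)[OF \<epsilon>lim, of 1, OF zero_less_one] lam
    proof (eventually_elim, intro allI impI)
      fix n f assume n: "\<bar>r n\<bar> \<le> \<bar>\<epsilon> (real n)\<bar>" "0 < \<epsilon> (real n)" "\<epsilon> (real n) < 1"
        "eigval T n = g (real n) * (c\<^sub>0 + \<sigma> * \<epsilon> (real n) + r n)"
        and f: "norm f = 1" "\<forall>i<n. cinner f (e i) = 0"
      have "cinner (T f) f \<in> \<real>\<^sub>\<ge>\<^sub>0" using assms(7) by (simp add: positive_op_def)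
      then have "cmod (cinner (T f) f) = Re (cinner (T f) f)"
        by (auto simp: complex_nonneg_Reals_iff cmod_eq_Re)
      also have "\<dots> \<le> eigval T n" using form[of n f] f by simp
      also have "\<dots> \<le> g (real n) * (\<bar>c\<^sub>0\<bar> + 2)"
        unfolding n(4) using n(1-3) assms(8) less_imp_le[OF posn[of n]] by (intro mult_left_mono) auto
      finally show "cmod (cinner (T f) f) \<le> (\<bar>c\<^sub>0\<bar> + 2) * g (real n)" by (simp add: mult.commute)
    qed
  qed
  have formS: "\<forall>\<^sub>F n in sequentially. \<forall>f. norm f = 1 \<longrightarrow> (\<forall>i<n. cinner f (e i) = 0) \<longrightarrow>
      cmod (cinner (S f) f) \<le> g (real n)"
    using eventually_ge_at_top[of N]
  proof (eventually_elim, intro allI impI)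
    fix n f assume n: "N \<le> n" and f: "norm f = 1" "\<forall>i<n. cinner f (e i) = 0"
    have "cinner f (e j) = 0 \<or> \<bar>g (real j)\<bar> \<le> g (real n)" for j
      using f(2) dec[of n j] n posn[of j] by (cases "j < n") auto
    then have "norm (S f) \<le> g (real n) * norm f"
      unfolding S_def using posn[of n] by (intro norm_series_op_le e) auto
    then show "cmod (cinner (S f) f) \<le> g (real n)"
      using cauchy_schwarz[of "S f" f] f(1) by simp
  qed
  have "a = 0 \<and> b = 0" if X: "fscale a T + fscale b S \<in> com_space g" for a b
  proof (rule ccontr)
    assume "\<not> (a = 0 \<and> b = 0)"
    then have ab: "a \<noteq> 0 \<or> b \<noteq> 0" by simp
    define s where "s j = a * complex_of_real (eigval T j) + b * complex_of_real (g (real j))" for j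
    have "\<forall>\<^sub>F n in sequentially. \<forall>f. norm f = 1 \<longrightarrow> (\<forall>i<n. cinner f (e i) = 0) \<longrightarrow>
      cmod (cinner ((fscale a T + fscale b S) f) f) \<le> (cmod a * (\<bar>c\<^sub>0\<bar> + 2) + cmod b) * g (real n)"
      using formT formS
    proof (eventually_elim, intro allI impI)
      fix n f assume n: "\<forall>f. norm f = 1 \<longrightarrow> (\<forall>i<n. cinner f (e i) = 0) \<longrightarrow>
          cmod (cinner (T f) f) \<le> (\<bar>c\<^sub>0\<bar> + 2) * g (real n)"
        "\<forall>f. norm f = 1 \<longrightarrow> (\<forall>i<n. cinner f (e i) = 0) \<longrightarrow> cmod (cinner (S f) f) \<le> g (real n)"
        and f: "norm f = 1" "\<forall>i<n. cinner f (e i) = 0"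
      have "cmod (cinner ((fscale a T + fscale b S) f) f)
          \<le> cmod a * cmod (cinner (T f) f) + cmod b * cmod (cinner (S f) f)"
        unfolding norm_mult[symmetric] by (simp add: fscale_def cinner_simps norm_triangle_ineq)
      also have "\<dots> \<le> cmod a * ((\<bar>c\<^sub>0\<bar> + 2) * g (real n)) + cmod b * g (real n)"
        using n f by (intro add_mono mult_left_mono) auto
      finally show "cmod (cinner ((fscale a T + fscale b S) f) f)
          \<le> (cmod a * (\<bar>c\<^sub>0\<bar> + 2) + cmod b) * g (real n)" by (simp add: algebra_simps)
    qed
    moreover have "(fscale a T + fscale b S) (e j) = cscale (s j) (e j)" for j
      by (simp add: fscale_def ev S_def series_op_basis[OF e e B] s_def cscale_add_left
          cscale_cscale flip: cscale_of_real)
    ultimately have "\<exists>D\<ge>0. \<forall>\<^sub>F n in sequentially. cmod (\<Sum>j<n. s j) \<le> D * (real n * g (real n))"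
      by (intro small_traces_eigenvalue_sums[OF posn com_space_small_traces[OF inf posn X] e])
    moreover obtain \<omega> \<delta> where "0 < \<delta>"
      "\<forall>\<^sub>F j in sequentially. \<delta> * (\<epsilon> (real j) * g (real j)) \<le> Re (\<omega> * s j)"
      using weights_one_sided[OF ab assms(8) \<epsilon>pos \<epsilon>lim assms(13) posn lam] unfolding s_def by blast
    ultimately show False
      using eigenvalue_sums_not_small[OF pos t1 assms(5,9) _ assms(11,15)] assms(10)
      by blast
  qed
  then show ?thesis
    unfolding S_def by (intro not_hypermeasurable_of_independent[OF e posn lim dec]) auto
qed

end
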